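(* Let $X$ be a complete noncompact length space with a universal cover $\tilde X$. If $$CovSpec^\infty_{rs}(X)\subset(0,1),$$ then $$CovSpec_{cut}(X)=\emptyset.$$
   Context: A complete length space is a complete metric space in which every pair of points is joined by a length-minimizing rectifiable curve whose length is the distance between the points. A universal cover $\tilde X$ of $X$ is a covering space of $X$ that covers every other covering space of $X$; it carries the lifted length metric, and each $g\in\pi_1(X)$ is viewed as a deck transformation of $\tilde X$. The infinite rescaled length of $g$ is $$L^\infty_{rs}(g)=\lim_{R\to\infty}\ \inf_{x\in X\setminus B_{x_0}(R)}\frac{d_{\tilde X}(g\tilde x,\tilde x)}{d_X(x,x_0)},$$ where $x_0\in X$ is any basepoint (the value does not depend on it) and $\tilde x$ ranges over the lifts of $x$. For $\delta>0$, $\pi^\infty_{rs}(X,\delta)$ is the subgroup of $\pi_1(X)$ generated by all $g$ with $L^\infty_{rs}(g)<2\delta$. The infinite rescaled covering spectrum $CovSpec^\infty_{rs}(X)$ is the set of all $\delta>0$ such that $\pi^\infty_{rs}(X,\delta)\neq\pi^\infty_{rs}(X,\delta')$ for all $\delta'>\delta$. Cut-off covering spectrum: fix $p\in X$. For $\delta,R>0$, the $R$ cut-off $\delta$ cover $\tilde X^{\delta,R}_{cut}$ is the covering space of $X$ whose covering group is the normal subgroup of $\pi_1(X,p)$ generated by the classes of loops $\alpha\beta\alpha^{-1}$, where $\alpha$ is a path starting at $p$ and $\beta$ is a loop based at the end of $\alpha$ which is contained either in some open ball of radius $\delta$ or in $X\setminus\overline{B_p(R)}$. The $R$ cut-off covering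 spectrum $CovSpec^R_{cut}(X,p)$ is the set of all $\delta>0$ such that $\tilde X^{\delta,R}_{cut}\neq\tilde X^{\delta',R}_{cut}$ for all $\delta'>\delta$. The cut-off covering spectrum is $CovSpec_{cut}(X)=Cl_{lower}\big(\bigcup_{R>0}CovSpec^R_{cut}(X,p)\big)$, where $Cl_{lower}(A)$ is the set of limits of nonincreasing sequences of points of $A$.
   Formalization: X is assumed unbounded as well as noncompact: in a bounded X the infimum defining the infinite rescaled length is over an empty set, and the claim fails, e.g. for a circle of length 1 with infinitely many unit segments glued at a point. *)

theory Defs
  imports "HOL-Analysis.Analysis" "HOL-Algebra.Generated_Groups"
begin

section \<open>Length spaces\<close>

text \<open>Supremum of the lengths of inscribed polygons; \<open>\<infinity>\<close> for non-rectifiable curves.\<close>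

definition curve_length :: "(real \<Rightarrow> 'a::metric_space) \<Rightarrow> ennreal" where
  "curve_length \<gamma> =
     (SUP ts \<in> {ts. sorted ts \<and> set ts \<subseteq> {0..1}}.
        \<Sum>i<length ts - 1. ennreal (dist (\<gamma> (ts ! i)) (\<gamma> (ts ! Suc i))))"

text \<open>Every curve from \<open>x\<close> to \<open>y\<close> has length at least \<open>dist x y\<close>, so a curve of length
  \<open>dist x y\<close> is minimizing and rectifiable.\<close>

definition length_space :: "'a::metric_space itself \<Rightarrow> bool" where
  "length_space _ \<longleftrightarrow>
     (\<forall>x y::'a. \<exists>\<gamma>. path \<gamma> \<and> pathstart \<gamma> = x \<and> pathfinish \<gamma> = y \<and>
        curve_length \<gamma> = ennreal (dist x y))"

section \<open>Fundamental group\<close>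

definition path_class :: "(real \<Rightarrow> 'a::topological_space) \<Rightarrow> (real \<Rightarrow> 'a) set" where
  "path_class \<gamma> = {\<gamma>'. homotopic_paths UNIV \<gamma> \<gamma>'}"

definition fundamental_group :: "'a::topological_space \<Rightarrow> (real \<Rightarrow> 'a) set monoid" where
  "fundamental_group p =
     \<lparr>carrier = {path_class \<gamma> |\<gamma>. path \<gamma> \<and> pathstart \<gamma> = p \<and> pathfinish \<gamma> = p},
      mult = (\<lambda>A B. \<Union>\<alpha>\<in>A. \<Union>\<beta>\<in>B. path_class (\<alpha> +++ \<beta>)),
      one = path_class (\<lambda>_. p)\<rparr>"

definition normal_closure :: "('g, 'm) monoid_scheme \<Rightarrow> 'g set \<Rightarrow> 'g set" where
  "normal_closure G S = \<Inter>{N. N \<lhd> G \<and> S \<subseteq> N}"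

section \<open>Covering spaces\<close>

text \<open>The analogue for abstract topologies of \<^const>\<open>covering_space\<close>, which is restricted to
  subsets of type class topological spaces and so does not allow quantification over covers.\<close>

definition covering_map :: "'b topology \<Rightarrow> ('b \<Rightarrow> 'c) \<Rightarrow> 'c topology \<Rightarrow> bool" where
  "covering_map E q B \<longleftrightarrow>
     continuous_map E B q \<and> q ` topspace E = topspace B \<and>
     (\<forall>x\<in>topspace B. \<exists>U. x \<in> U \<and> openin B U \<and>
        (\<exists>V. \<Union>V = {e \<in> topspace E. q e \<in> U} \<and> (\<forall>v\<in>V. openin E v) \<and> pairwise disjnt V \<and>
             (\<forall>v\<in>V. homeomorphic_map (subtopology E v) (subtopology B U) q)))"

text \<open>Covering spaces are understood to be connected.\<close>

definition cover_of_space :: "'b topology \<Rightarrow> ('b \<Rightarrow> 'a::topological_space) \<Rightarrow> bool" where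
  "cover_of_space E q \<longleftrightarrow> connected_space E \<and> covering_map E q euclidean"

definition cover_isomorphic ::
    "'b topology \<Rightarrow> ('b \<Rightarrow> 'a) \<Rightarrow> 'c topology \<Rightarrow> ('c \<Rightarrow> 'a) \<Rightarrow> bool" where
  "cover_isomorphic E q E' q' \<longleftrightarrow>
     (\<exists>h. homeomorphic_map E E' h \<and> (\<forall>e\<in>topspace E. q' (h e) = q e))"

text \<open>The image of the fundamental group of \<open>E\<close> at \<open>e\<close> in that of the base at \<open>q e\<close>.\<close>

definition covering_group ::
    "'b topology \<Rightarrow> ('b \<Rightarrow> 'a::topological_space) \<Rightarrow> 'b \<Rightarrow> (real \<Rightarrow> 'a) set set" where
  "covering_group E q e = {path_class (q \<circ> \<gamma>) |\<gamma>. pathin E \<gamma> \<and> \<gamma> 0 = e \<and> \<gamma> 1 = e}"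

text \<open>HOL cannot quantify over spaces of all types. If the base is connected and locally path
  connected (as length spaces are), every connected cover is path connected, and sending each of
  its points \<open>e\<close> to the set of projections to the base of paths from a base point to \<open>e\<close> is
  injective by uniqueness of lifts; so every connected cover is isomorphic to one carried by the
  type \<open>(real \<Rightarrow> 'a) set\<close>. Quantifying over topologies on that type therefore loses nothing.\<close>

definition universal_cover :: "'b topology \<Rightarrow> ('b \<Rightarrow> 'a::topological_space) \<Rightarrow> bool" where
  "universal_cover E \<pi> \<longleftrightarrow> cover_of_space E \<pi> \<and>
     (\<forall>(E' :: (real \<Rightarrow> 'a) set topology) q. cover_of_space E' q \<longrightarrow>
        (\<exists>f. covering_map E f E' \<and> (\<forall>e\<in>topspace E. q (f e) = \<pi> e)))"

definition lifted_dist :: "'b topology \<Rightarrow> ('b \<Rightarrow> 'a::metric_space) \<Rightarrow> 'b \<Rightarrow> 'b \<Rightarrow> ennreal" where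
  "lifted_dist E \<pi> x y = (INF \<gamma> \<in> {\<gamma>. pathin E \<gamma> \<and> \<gamma> 0 = x \<and> \<gamma> 1 = y}. curve_length (\<pi> \<circ> \<gamma>))"

definition deck_transformation :: "'b topology \<Rightarrow> ('b \<Rightarrow> 'a) \<Rightarrow> ('b \<Rightarrow> 'b) \<Rightarrow> bool" where
  "deck_transformation E \<pi> h \<longleftrightarrow> homeomorphic_map E E h \<and> (\<forall>e\<in>topspace E. \<pi> (h e) = \<pi> e)"

text \<open>The deck transformation given by \<open>g\<close> in the fundamental group at \<open>\<pi> e0\<close>: the one moving \<open>e0\<close>
  to the end of the lift at \<open>e0\<close> of a loop in \<open>g\<close>. On a universal cover of a length space it exists
  and is unique on \<open>topspace E\<close>; its values elsewhere are irrelevant.\<close>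

definition deck_action ::
    "'b topology \<Rightarrow> ('b \<Rightarrow> 'a::topological_space) \<Rightarrow> 'b \<Rightarrow> (real \<Rightarrow> 'a) set \<Rightarrow> 'b \<Rightarrow> 'b" where
  "deck_action E \<pi> e0 g =
     (SOME h. deck_transformation E \<pi> h \<and>
        (\<exists>\<gamma>. pathin E \<gamma> \<and> \<gamma> 0 = e0 \<and> path_class (\<pi> \<circ> \<gamma>) = g \<and> h e0 = \<gamma> 1))"

section \<open>The infinite rescaled covering spectrum\<close>

text \<open>The infimum ranges jointly over the points \<open>\<pi> e\<close> outside the ball and their lifts \<open>e\<close>. The
  point \<open>x0\<close> is the base point for distances; \<open>e0\<close> fixes the action of the fundamental group.\<close>

definition inf_rescaled_length ::
    "'b topology \<Rightarrow> ('b \<Rightarrow> 'a::metric_space) \<Rightarrow> 'b \<Rightarrow> 'a \<Rightarrow> (real \<Rightarrow> 'a) set \<Rightarrow> ennreal" where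
  "inf_rescaled_length E \<pi> e0 x0 g =
     Lim at_top (\<lambda>R::real. INF e \<in> {e \<in> topspace E. \<pi> e \<notin> ball x0 R}.
        lifted_dist E \<pi> (deck_action E \<pi> e0 g e) e / ennreal (dist (\<pi> e) x0))"

definition pi_rs_inf ::
    "'b topology \<Rightarrow> ('b \<Rightarrow> 'a::metric_space) \<Rightarrow> 'b \<Rightarrow> 'a \<Rightarrow> real \<Rightarrow> (real \<Rightarrow> 'a) set set" where
  "pi_rs_inf E \<pi> e0 x0 \<delta> =
     generate (fundamental_group (\<pi> e0))
       {g \<in> carrier (fundamental_group (\<pi> e0)). inf_rescaled_length E \<pi> e0 x0 g < ennreal (2 * \<delta>)}"

definition CovSpec_rs_inf ::
    "'b topology \<Rightarrow> ('b \<Rightarrow> 'a::metric_space) \<Rightarrow> 'b \<Rightarrow> 'a \<Rightarrow> real set" where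
  "CovSpec_rs_inf E \<pi> e0 x0 =
     {\<delta>. \<delta> > 0 \<and> (\<forall>\<delta>'>\<delta>. pi_rs_inf E \<pi> e0 x0 \<delta> \<noteq> pi_rs_inf E \<pi> e0 x0 \<delta>')}"

section \<open>The cut-off covering spectrum\<close>

definition cutoff_generators :: "'a::metric_space \<Rightarrow> real \<Rightarrow> real \<Rightarrow> (real \<Rightarrow> 'a) set set" where
  "cutoff_generators p \<delta> R =
     {path_class (\<alpha> +++ \<beta> +++ reversepath \<alpha>) |\<alpha> \<beta>.
        path \<alpha> \<and> pathstart \<alpha> = p \<and>
        path \<beta> \<and> pathstart \<beta> = pathfinish \<alpha> \<and> pathfinish \<beta> = pathfinish \<alpha> \<and>
        ((\<exists>x. path_image \<beta> \<subseteq> ball x \<delta>) \<or> path_image \<beta> \<subseteq> - closure (ball p R))}"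

definition is_cutoff_cover ::
    "'a::metric_space \<Rightarrow> real \<Rightarrow> real \<Rightarrow> 'b topology \<Rightarrow> ('b \<Rightarrow> 'a) \<Rightarrow> bool" where
  "is_cutoff_cover p \<delta> R E q \<longleftrightarrow> cover_of_space E q \<and>
     (\<exists>e\<in>topspace E. q e = p \<and>
        covering_group E q e = normal_closure (fundamental_group p) (cutoff_generators p \<delta> R))"

text \<open>The cut-off cover exists and is unique up to isomorphism, and covers are distinguished up to
  isomorphism over the base.\<close>

definition CovSpec_cut_R :: "'a::metric_space \<Rightarrow> real \<Rightarrow> real set" where
  "CovSpec_cut_R p R =
     {\<delta>. \<delta> > 0 \<and>
        (\<forall>\<delta>'>\<delta>. \<forall>(E :: (real \<Rightarrow> 'a) set topology) q (E' :: (real \<Rightarrow> 'a) set topology) q'.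
           is_cutoff_cover p \<delta> R E q \<and> is_cutoff_cover p \<delta>' R E' q' \<longrightarrow>
           \<not> cover_isomorphic E q E' q')}"

definition Cl_lower :: "real set \<Rightarrow> real set" where
  "Cl_lower A = {x. \<exists>s::nat \<Rightarrow> real. range s \<subseteq> A \<and> decseq s \<and> s \<longlonglongrightarrow> x}"

definition CovSpec_cut :: "'a::metric_space \<Rightarrow> real set" where
  "CovSpec_cut p = Cl_lower (\<Union>R\<in>{0<..}. CovSpec_cut_R p R)"

end

theory Submission
  imports Defs
begin

text \<open>
  The loops whose classes generate \<open>pi_rs_inf 1\<close> have rescaled length below \<open>2\<close>. This means that
  arbitrarily far from the base point \<open>x0\<close>, at some point \<open>x\<close> at distance \<open>d\<close>, the class is
  represented, up to free homotopy and up to loops that lift to closed loops in the universal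
  cover, by a loop at \<open>x\<close> of length less than \<open>r d\<close> for a fixed \<open>r < 2\<close>. Such a loop stays at distance
  at least \<open>(1 - r / 2) d\<close> from \<open>x0\<close>, hence outside any given ball, so its conjugates are among the
  generators of the group of every \<open>R\<close> cut-off \<open>\<delta>\<close> cover
  (\<open>base_change_in_normal_if_short\<close>).

  On the other hand, the rescaled length of every class is at most \<open>2\<close>: go from a far point back to
  the base point along a geodesic, around a fixed loop, and out again
  (\<open>inf_rescaled_length_le_2\<close>). So the group at any \<open>\<delta> > 1\<close> is the full fundamental group. If the
  rescaled spectrum lies in \<open>(0, 1)\<close>, then \<open>1\<close> is not in it, and the full group is already generated
  by the classes of rescaled length below \<open>2\<close>. By the first paragraph every cut-off cover then
  has the full fundamental group as its covering group, so no cut-off cover ever changes with \<open>\<delta>\<close>.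

  The universal cover is not assumed simply connected; it is only known to cover all connected
  covers. Two things have to be extracted from this. Elements of the fundamental group must act by deck
  transformations (\<open>deck_transformation_exists\<close>), that is, the cover must be regular; and loops which lift to closed
  loops must lie in every normal subgroup that contains the classes of small loops
  (\<open>closed_lift_in_normal\<close>). Both follow from one construction: a suitable congruence \<open>\<asymp>\<close> on
  the paths from a point defines a covering space whose points are the classes
  (locale \<open>path_congruence\<close>). The universal cover maps to it, so a path \<open>\<rho>\<close> with a closed lift
  satisfies \<open>\<gamma> +++ \<rho> \<asymp> \<gamma>\<close> for some \<open>\<gamma>\<close> (\<open>closed_lift_congruent\<close>). Applied to the congruence
  of having the same effect on the fibres of the universal cover this gives regularity; applied to the
  congruence modulo a normal subgroup it gives membership. The latter also provides the cut-off
  covers themselves (\<open>cutoff_cover_exists\<close>).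
\<close>

section \<open>Lifting along coverings\<close>

text \<open>An evenly covered set in terms of the inverses of its sheets: \<open>s e\<close> is the section through \<open>e\<close>.
That \<open>s (s e y) = s e\<close> encodes the disjointness of distinct sheets.\<close>

definition local_sections ::
    "'b topology \<Rightarrow> ('b \<Rightarrow> 'a::topological_space) \<Rightarrow> 'a set \<Rightarrow> ('b \<Rightarrow> 'a \<Rightarrow> 'b) \<Rightarrow> bool" where
  "local_sections E \<pi> B s \<longleftrightarrow>
     (\<forall>e\<in>topspace E. \<pi> e \<in> B \<longrightarrow>
        continuous_map (top_of_set B) E (s e) \<and> s e (\<pi> e) = e \<and> openin E (s e ` B) \<and>
        (\<forall>y\<in>B. \<pi> (s e y) = y \<and> s (s e y) = s e))"

lemma local_sectionsD:
  assumes "local_sections E \<pi> B s" "e \<in> topspace E" "\<pi> e \<in> B"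
  shows "continuous_map (top_of_set B) E (s e)" "s e (\<pi> e) = e" "openin E (s e ` B)"
    "\<And>y. y \<in> B \<Longrightarrow> \<pi> (s e y) = y" "\<And>y. y \<in> B \<Longrightarrow> s (s e y) = s e"
    "\<And>y. y \<in> B \<Longrightarrow> s e y \<in> topspace E"
  using assms unfolding local_sections_def by (auto simp: continuous_map_def Pi_iff)

lemma covering_map_local_sections:
  fixes \<pi> :: "'b \<Rightarrow> 'a::metric_space"
  assumes cov: "covering_map E \<pi> euclidean"
  obtains r s where "r > 0" "local_sections E \<pi> (ball x r) s"
proof -
  have "\<exists>U. x \<in> U \<and> openin euclidean U \<and>
      (\<exists>\<V>. \<Union>\<V> = {e \<in> topspace E. \<pi> e \<in> U} \<and> (\<forall>v\<in>\<V>. openin E v) \<and> pairwise disjnt \<V> \<and>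
        (\<forall>v\<in>\<V>. homeomorphic_map (subtopology E v) (top_of_set U) \<pi>))"
    using cov unfolding covering_map_def by simp
  then obtain U \<V> where U: "x \<in> U" "openin euclidean U"
    and \<V>: "\<Union>\<V> = {e \<in> topspace E. \<pi> e \<in> U}" "\<forall>v\<in>\<V>. openin E v" "pairwise disjnt \<V>"
      "\<forall>v\<in>\<V>. homeomorphic_map (subtopology E v) (top_of_set U) \<pi>"
    by (elim exE conjE)
  obtain r where r: "r > 0" "ball x r \<subseteq> U"
    using U open_contains_ball open_openin by blast
  define v where "v e = (SOME v. v \<in> \<V> \<and> e \<in> v)" for e
  define s where "s e = inv_into (v e) \<pi>" for e
  have "local_sections E \<pi> (ball x r) s"
    unfolding local_sections_def
  proof (intro ballI impI)
    fix e assume e: "e \<in> topspace E" "\<pi> e \<in> ball x r"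
    have "\<exists>v. v \<in> \<V> \<and> e \<in> v"
      using e r \<V>(1) by blast
    then have ve: "v e \<in> \<V>" "e \<in> v e"
      unfolding v_def by (metis (no_types, lifting) someI_ex)+
    have v_eq: "v e' = v e" if "e' \<in> v e" for e'
    proof -
      have "v e' \<in> \<V> \<and> e' \<in> v e'"
        unfolding v_def using ve that by (metis (no_types, lifting) someI_ex)
      then show ?thesis
        using \<V>(3) that ve(1) by (metis pairwiseD disjnt_iff)
    qed
    have sub: "v e \<subseteq> topspace E"
      by (simp add: \<V>(2) openin_subset ve(1))
    have hom: "homeomorphic_map (subtopology E (v e)) (top_of_set U) \<pi>"
      using \<V>(4) ve by blast
    have img: "\<pi> ` v e = U" and inj: "inj_on \<pi> (v e)"
      using hom sub by (simp_all add: homeomorphic_eq_everything_map Int_absorb1)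
    have mem: "s e y \<in> v e" "\<pi> (s e y) = y" if "y \<in> U" for y
      unfolding s_def using img that by (auto simp: inv_into_into f_inv_into_f)
    obtain g where g: "homeomorphic_maps (subtopology E (v e)) (top_of_set U) \<pi> g"
      using hom homeomorphic_map_maps by blast
    have gs: "g y = s e y" if "y \<in> U" for y
    proof -
      have "g (\<pi> (s e y)) = s e y"
        using g mem(1)[OF that] sub unfolding homeomorphic_maps_def by auto
      then show ?thesis by (simp add: mem(2)[OF that])
    qed
    have "continuous_map (top_of_set U) E g"
      using g unfolding homeomorphic_maps_def continuous_map_in_subtopology by blast
    then have "continuous_map (top_of_set U) E (s e)"
      by (rule continuous_map_eq) (use gs in auto)
    then have cont: "continuous_map (top_of_set (ball x r)) E (s e)"
      using continuous_map_from_subtopology_mono r(2) by blast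
    have "s e ` ball x r = {e' \<in> topspace E. \<pi> e' \<in> ball x r} \<inter> v e"
    proof (intro equalityI subsetI)
      fix e' assume "e' \<in> {e' \<in> topspace E. \<pi> e' \<in> ball x r} \<inter> v e"
      then show "e' \<in> s e ` ball x r"
        using inj unfolding s_def by (intro image_eqI[of _ _ "\<pi> e'"]) auto
    qed (use mem r sub in \<open>auto simp: subset_iff\<close>)
    moreover have "openin E {e' \<in> topspace E. \<pi> e' \<in> ball x r}"
      using cov openin_continuous_map_preimage[of E euclidean \<pi> "ball x r"]
      by (simp add: covering_map_def)
    ultimately have "openin E (s e ` ball x r)"
      using \<V>(2) ve by auto
    moreover have "s e (\<pi> e) = e"
      using inj ve by (simp add: s_def)
    moreover have "\<pi> (s e y) = y \<and> s (s e y) = s e" if "y \<in> ball x r" for y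
      using mem[of y] v_eq[of "s e y"] r(2) that by (auto simp: s_def)
    ultimately show "continuous_map (top_of_set (ball x r)) E (s e) \<and> s e (\<pi> e) = e \<and>
        openin E (s e ` ball x r) \<and> (\<forall>y\<in>ball x r. \<pi> (s e y) = y \<and> s (s e y) = s e)"
      using cont by blast
  qed
  with r that show thesis by blast
qed

text \<open>The set on which two lifts agree is open and closed, because near each point both are given by
local sections, which coincide or have disjoint images.\<close>

lemma lifts_equal:
  fixes \<pi> :: "'b \<Rightarrow> 'a::metric_space"
  assumes cov: "covering_map E \<pi> euclidean" and T: "connected_space T"
    and f: "continuous_map T E f" and g: "continuous_map T E g"
    and fg: "\<And>t. t \<in> topspace T \<Longrightarrow> \<pi> (f t) = \<pi> (g t)"
    and t0: "t0 \<in> topspace T" "f t0 = g t0" and t: "t \<in> topspace T"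
  shows "f t = g t"
proof -
  define A where "A = {t \<in> topspace T. f t = g t}"
  have fE: "f t \<in> topspace E" and gE: "g t \<in> topspace E" if "t \<in> topspace T" for t
    using f g that by (auto simp: continuous_map_def Pi_iff)
  \<comment> \<open>Near \<open>t\<close> each of \<open>f\<close>, \<open>g\<close> is a local section applied to the common projection, and two such
    sections either coincide or have disjoint images.\<close>
  have nbhd: "\<exists>W. openin T W \<and> t \<in> W \<and> (\<forall>t'\<in>W. f t' = g t' \<longleftrightarrow> f t = g t)"
    if t: "t \<in> topspace T" for t
  proof -
    obtain r s where r: "r > 0" and s: "local_sections E \<pi> (ball (\<pi> (f t)) r) s"
      using covering_map_local_sections[OF cov] by blast
    let ?B = "ball (\<pi> (f t)) r"
    note sf = local_sectionsD[OF s fE[OF t]]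
    note sg = local_sectionsD[OF s gE[OF t]]
    let ?W = "{t' \<in> topspace T. f t' \<in> s (f t) ` ?B} \<inter> {t' \<in> topspace T. g t' \<in> s (g t) ` ?B}"
    have gB: "\<pi> (g t) \<in> ?B" and fB: "\<pi> (f t) \<in> ?B"
      using fg[OF t] r by auto
    note sf = sf[OF fB] and sg = sg[OF gB]
    have W: "openin T ?W"
      using sf(3) sg(3) f g by (auto intro!: openin_continuous_map_preimage)
    have tW: "t \<in> ?W"
      using imageI[OF fB, of "s (f t)"] imageI[OF gB, of "s (g t)"] sf(2) sg(2) t by simp
    have "f t' = g t' \<longleftrightarrow> f t = g t" if t': "t' \<in> ?W" for t'
    proof -
      obtain y where y: "y \<in> ?B" "f t' = s (f t) y" using t' by blast
      obtain z where z: "z \<in> ?B" "g t' = s (g t) z" using t' by blast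
      have "\<pi> (f t') = y" "\<pi> (g t') = z"
        using sf(4)[OF y(1), folded y(2)] sg(4)[OF z(1), folded z(2)] by blast+
      moreover have "t' \<in> topspace T" using t' by blast
      ultimately have zy: "z = y"
        using fg by force
      show ?thesis
      proof
        assume "f t' = g t'"
        then have "s (f t) = s (g t)"
          using sf(5)[OF y(1), folded y(2)] sg(5)[OF z(1), folded z(2)] by metis
        then have "s (f t) (\<pi> (f t)) = s (g t) (\<pi> (g t))"
          by (metis fg[OF t])
        then show "f t = g t"
          using sf(2) sg(2) by metis
      next
        assume "f t = g t"
        then have "s (f t) y = s (g t) z"
          by (simp only: zy)
        then show "f t' = g t'"
          by (simp only: y(2) z(2))
      qed
    qed
    with W tW show ?thesis by blast
  qed
  have "openin T A"
  proof (subst openin_subopen, intro ballI)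
    fix t assume "t \<in> A"
    then have t: "t \<in> topspace T" "f t = g t" by (auto simp: A_def)
    obtain W where W: "openin T W" "t \<in> W" "\<forall>t'\<in>W. f t' = g t' \<longleftrightarrow> f t = g t"
      using nbhd[OF t(1)] by blast
    then have "W \<subseteq> A"
      using openin_subset[OF W(1)] t(2) by (auto simp: A_def)
    with W(1,2) show "\<exists>W. openin T W \<and> t \<in> W \<and> W \<subseteq> A" by blast
  qed
  moreover have "openin T (topspace T - A)"
  proof (subst openin_subopen, intro ballI)
    fix t assume "t \<in> topspace T - A"
    then have t: "t \<in> topspace T" "f t \<noteq> g t" by (auto simp: A_def)
    obtain W where W: "openin T W" "t \<in> W" "\<forall>t'\<in>W. f t' = g t' \<longleftrightarrow> f t = g t"
      using nbhd[OF t(1)] by blast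
    then have "W \<subseteq> topspace T - A"
      using openin_subset[OF W(1)] t(2) by (auto simp: A_def)
    with W(1,2) show "\<exists>W. openin T W \<and> t \<in> W \<and> W \<subseteq> topspace T - A" by blast
  qed
  moreover have "A \<subseteq> topspace T" "t0 \<in> A"
    using t0 by (auto simp: A_def)
  ultimately have "A = topspace T"
    using T unfolding connected_space_clopen_in closedin_def by blast
  then show ?thesis
    using t by (auto simp: A_def)
qed

lemma path_lifting:
  fixes \<pi> :: "'b \<Rightarrow> 'a::metric_space"
  assumes cov: "covering_map E \<pi> euclidean" and \<gamma>: "path \<gamma>"
    and e: "e \<in> topspace E" "\<pi> e = pathstart \<gamma>"
  obtains \<sigma> where "pathin E \<sigma>" "\<sigma> 0 = e" "\<And>t. t \<in> {0..1} \<Longrightarrow> \<pi> (\<sigma> t) = \<gamma> t"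
proof -
  \<comment> \<open>The local step of \<open>Bolzano\<close> meets intervals that stick out of the unit interval, so
    \<open>\<gamma>\<close> is extended to a continuous map on the line.\<close>
  define c where "c t = \<gamma> (max 0 (min 1 t))" for t
  have c: "continuous_on UNIV c"
    unfolding c_def
    by (rule continuous_on_compose2[OF \<gamma>[unfolded path_def]]) (auto intro!: continuous_intros)
  define P where "P a b \<longleftrightarrow> (a \<le> b \<longrightarrow> (\<forall>e\<in>topspace E. \<pi> e = c a \<longrightarrow>
      (\<exists>\<sigma>. continuous_map (top_of_set {a..b}) E \<sigma> \<and> \<sigma> a = e \<and> (\<forall>t\<in>{a..b}. \<pi> (\<sigma> t) = c t))))"
    for a b
  have "P 0 1"
    using zero_le_one[where 'a=real]
  proof (induction rule: Bolzano)
    case (trans a b d)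
    show ?case
      unfolding P_def
    proof (intro impI ballI)
      fix e assume e: "e \<in> topspace E" "\<pi> e = c a"
      obtain \<sigma> where \<sigma>: "continuous_map (top_of_set {a..b}) E \<sigma>" "\<sigma> a = e"
          "\<And>t. t \<in> {a..b} \<Longrightarrow> \<pi> (\<sigma> t) = c t"
        using trans(1,3) e unfolding P_def by blast
      have "\<sigma> b \<in> topspace E"
        using \<sigma>(1) trans(3) by (auto simp: continuous_map_def Pi_iff)
      then obtain \<tau> where \<tau>: "continuous_map (top_of_set {b..d}) E \<tau>" "\<tau> b = \<sigma> b"
          "\<And>t. t \<in> {b..d} \<Longrightarrow> \<pi> (\<tau> t) = c t"
        using trans(2-4) \<sigma>(3)[of b] unfolding P_def by (metis atLeastAtMost_iff order_refl)
      have "continuous_map (top_of_set {a..d}) E (\<lambda>t. if t \<le> b then \<sigma> t else \<tau> t)"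
      proof (rule continuous_map_cases_le)
        show "continuous_map (top_of_set {a..d}) euclideanreal (\<lambda>t. t)"
          "continuous_map (top_of_set {a..d}) euclideanreal (\<lambda>t. b)" by auto
        show "continuous_map (subtopology (top_of_set {a..d}) {x \<in> topspace (top_of_set {a..d}). x \<le> b}) E \<sigma>"
          using \<sigma>(1) by (auto simp: subtopology_subtopology elim!: continuous_map_from_subtopology_mono)
        show "continuous_map (subtopology (top_of_set {a..d}) {x \<in> topspace (top_of_set {a..d}). b \<le> x}) E \<tau>"
          using \<tau>(1) by (auto simp: subtopology_subtopology elim!: continuous_map_from_subtopology_mono)
      qed (use \<tau> in auto)
      moreover have "\<forall>t\<in>{a..d}. \<pi> (if t \<le> b then \<sigma> t else \<tau> t) = c t"
        using \<sigma>(3) \<tau>(3) by auto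
      ultimately show "\<exists>\<sigma>. continuous_map (top_of_set {a..d}) E \<sigma> \<and> \<sigma> a = e \<and> (\<forall>t\<in>{a..d}. \<pi> (\<sigma> t) = c t)"
        using \<sigma>(2) trans(3) by (intro exI[of _ "\<lambda>t. if t \<le> b then \<sigma> t else \<tau> t"]) auto
    qed
  next
    case (local x)
    obtain r s where r: "r > 0" and s: "local_sections E \<pi> (ball (c x) r) s"
      using covering_map_local_sections[OF cov] by blast
    obtain d where d: "d > 0" "\<And>t. dist t x < d \<Longrightarrow> c t \<in> ball (c x) r"
      using c r unfolding continuous_on_iff by (metis UNIV_I dist_commute mem_ball)
    have "P a b" if ab: "a \<le> x" "x \<le> b" "b - a < d" for a b
      unfolding P_def
    proof (intro impI ballI)
      fix e assume e: "e \<in> topspace E" "\<pi> e = c a"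
      have im: "c t \<in> ball (c x) r" if "t \<in> {a..b}" for t
        by (rule d(2)) (use that ab in \<open>auto simp: dist_real_def\<close>)
      have e': "\<pi> e \<in> ball (c x) r"
        using im[of a] e ab by auto
      note se = local_sectionsD[OF s e(1) e']
      have "continuous_map (top_of_set {a..b}) (top_of_set (ball (c x) r)) c"
        using im c continuous_on_subset by (fastforce simp: continuous_map_in_subtopology)
      then have "continuous_map (top_of_set {a..b}) E (s e \<circ> c)"
        using se(1) continuous_map_compose by blast
      then show "\<exists>\<sigma>. continuous_map (top_of_set {a..b}) E \<sigma> \<and> \<sigma> a = e \<and> (\<forall>t\<in>{a..b}. \<pi> (\<sigma> t) = c t)"
        using se(2,4) e im by (intro exI[of _ "s e \<circ> c"]) auto
    qed
    then show ?case using d by blast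
  qed
  then have P01: "\<And>e. e \<in> topspace E \<Longrightarrow> \<pi> e = c 0 \<Longrightarrow>
      \<exists>\<sigma>. continuous_map (top_of_set {0..1}) E \<sigma> \<and> \<sigma> 0 = e \<and> (\<forall>t\<in>{0..1}. \<pi> (\<sigma> t) = c t)"
    unfolding P_def by simp
  have c_eq: "c t = \<gamma> t" if "t \<in> {0..1}" for t
    using that by (auto simp: c_def max_def min_def)
  have "\<pi> e = c 0"
    using e c_eq[of 0] by (simp add: pathstart_def)
  then obtain \<sigma> where
    "continuous_map (top_of_set {0..1}) E \<sigma>" "\<sigma> 0 = e" "\<forall>t\<in>{0..1}. \<pi> (\<sigma> t) = c t"
    using P01[OF e(1)] by blast
  then show thesis
    using that c_eq unfolding pathin_def by simp
qed

text \<open>The action of paths on the fibres, \<open>transport\<close>, is the language for all later statements about lifts: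
it turns concatenation into composition and is determined by path lifting and its uniqueness.\<close>

locale covering =
  fixes E :: "'b topology" and \<pi> :: "'b \<Rightarrow> 'a::metric_space"
  assumes covering_map: "covering_map E \<pi> euclidean"
begin

lemma continuous_map_projection: "continuous_map E euclidean \<pi>"
  using covering_map unfolding covering_map_def by simp

definition lift :: "(real \<Rightarrow> 'a) \<Rightarrow> 'b \<Rightarrow> real \<Rightarrow> 'b" where
  "lift \<gamma> e = (SOME \<sigma>. pathin E \<sigma> \<and> \<sigma> 0 = e \<and> (\<forall>t\<in>{0..1}. \<pi> (\<sigma> t) = \<gamma> t))"

definition transport :: "(real \<Rightarrow> 'a) \<Rightarrow> 'b \<Rightarrow> 'b" where
  "transport \<gamma> e = lift \<gamma> e 1"

lemma lift_equality:
  assumes "pathin E \<sigma>" "\<And>t. t \<in> {0..1} \<Longrightarrow> \<pi> (\<sigma> t) = \<gamma> t" and t: "t \<in> {0..1}"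
  shows "lift \<gamma> (\<sigma> 0) t = \<sigma> t"
proof -
  have "pathin E (lift \<gamma> (\<sigma> 0)) \<and> lift \<gamma> (\<sigma> 0) 0 = \<sigma> 0 \<and> (\<forall>t\<in>{0..1}. \<pi> (lift \<gamma> (\<sigma> 0) t) = \<gamma> t)"
    unfolding lift_def by (rule someI[of _ \<sigma>]) (use assms in auto)
  then have l: "pathin E (lift \<gamma> (\<sigma> 0))" "lift \<gamma> (\<sigma> 0) 0 = \<sigma> 0"
      "\<And>t. t \<in> {0..1} \<Longrightarrow> \<pi> (lift \<gamma> (\<sigma> 0) t) = \<gamma> t"
    by auto
  show ?thesis
  proof (rule lifts_equal[OF covering_map, where f = "lift \<gamma> (\<sigma> 0)" and g = \<sigma>])
    show "connected_space (top_of_set {0..1::real})"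
      by (simp add: connected_space_subtopology)
    show "continuous_map (top_of_set {0..1}) E (lift \<gamma> (\<sigma> 0))"
      using l(1) by (simp add: pathin_def)
    show "continuous_map (top_of_set {0..1}) E \<sigma>"
      using assms(1) by (simp add: pathin_def)
    show "\<pi> (lift \<gamma> (\<sigma> 0) t) = \<pi> (\<sigma> t)" if "t \<in> topspace (top_of_set {0..1})" for t
      using that l(3)[of t] assms(2)[of t] by simp
    show "lift \<gamma> (\<sigma> 0) 0 = \<sigma> 0" by (rule l(2))
  qed (use t in auto)
qed

lemma transport_equality:
  assumes "pathin E \<sigma>" "\<And>t. t \<in> {0..1} \<Longrightarrow> \<pi> (\<sigma> t) = \<gamma> t"
  shows "transport \<gamma> (\<sigma> 0) = \<sigma> 1"
  using lift_equality[OF assms, of 1] by (simp add: transport_def)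

lemma
  assumes "path \<gamma>" "e \<in> topspace E" "\<pi> e = pathstart \<gamma>"
  shows pathin_lift: "pathin E (lift \<gamma> e)"
    and lift_0: "lift \<gamma> e 0 = e"
    and projection_lift: "\<And>t. t \<in> {0..1} \<Longrightarrow> \<pi> (lift \<gamma> e t) = \<gamma> t"
proof -
  obtain \<sigma> where "pathin E \<sigma> \<and> \<sigma> 0 = e \<and> (\<forall>t\<in>{0..1}. \<pi> (\<sigma> t) = \<gamma> t)"
    using path_lifting[OF covering_map assms] by metis
  then have "pathin E (lift \<gamma> e) \<and> lift \<gamma> e 0 = e \<and> (\<forall>t\<in>{0..1}. \<pi> (lift \<gamma> e t) = \<gamma> t)"
    unfolding lift_def
    by (rule someI[of "\<lambda>\<sigma>. pathin E \<sigma> \<and> \<sigma> 0 = e \<and> (\<forall>t\<in>{0..1}. \<pi> (\<sigma> t) = \<gamma> t)"])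
  then show "pathin E (lift \<gamma> e)" "lift \<gamma> e 0 = e"
    "\<And>t. t \<in> {0..1} \<Longrightarrow> \<pi> (lift \<gamma> e t) = \<gamma> t" by auto
qed

lemma lift_topspace:
  assumes "path \<gamma>" "e \<in> topspace E" "\<pi> e = pathstart \<gamma>" "t \<in> {0..1}"
  shows "lift \<gamma> e t \<in> topspace E"
  using pathin_lift[OF assms(1-3)] assms(4) by (auto simp: pathin_def continuous_map_def Pi_iff)

lemma
  assumes "path \<gamma>" "e \<in> topspace E" "\<pi> e = pathstart \<gamma>"
  shows transport_topspace: "transport \<gamma> e \<in> topspace E"
    and projection_transport: "\<pi> (transport \<gamma> e) = pathfinish \<gamma>"
  using lift_topspace[OF assms, of 1] projection_lift[OF assms, of 1]
  by (auto simp: transport_def pathfinish_def)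

lemma pathin_reparametrize:
  assumes "pathin E \<sigma>" "path \<phi>" "path_image \<phi> \<subseteq> {0..1}"
  shows "pathin E (\<sigma> \<circ> \<phi>)"
  using assms unfolding pathin_def path_def path_image_def
  by (intro continuous_map_compose[of _ "top_of_set {0..1}"])
     (auto simp: continuous_map_in_subtopology)

lemma transport_segment:
  assumes \<gamma>: "path \<gamma>" "e \<in> topspace E" "\<pi> e = pathstart \<gamma>" and st: "s \<in> {0..1}" "t \<in> {0..1}"
  shows "transport (\<gamma> \<circ> linepath s t) (lift \<gamma> e s) = lift \<gamma> e t"
proof -
  have im: "path_image (linepath s t) \<subseteq> {0..1}"
    using st by (simp add: closed_segment_subset)
  then have im': "linepath s t u \<in> {0..1}" if "u \<in> {0..1}" for u
    using that unfolding path_image_def by blast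
  have "transport (\<gamma> \<circ> linepath s t) ((lift \<gamma> e \<circ> linepath s t) 0) = (lift \<gamma> e \<circ> linepath s t) 1"
    using im' projection_lift[OF \<gamma>]
    by (intro transport_equality pathin_reparametrize[OF pathin_lift[OF \<gamma>] _ im]) auto
  then show ?thesis by (simp add: linepath_0' linepath_1')
qed

lemma transport_cong:
  assumes "path \<gamma>" "e \<in> topspace E" "\<pi> e = pathstart \<gamma>" "\<And>t. t \<in> {0..1} \<Longrightarrow> \<gamma> t = \<gamma>' t"
  shows "transport \<gamma>' e = transport \<gamma> e"
  using transport_equality[OF pathin_lift[OF assms(1-3)], of \<gamma>'] projection_lift[OF assms(1-3)]
    assms(4) lift_0[OF assms(1-3)] by (simp add: transport_def)

text \<open>The lift of the whole path restricts to lifts of its two halves, so no gluing is needed.\<close>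

lemma transport_join:
  assumes \<gamma>: "path \<gamma>" "e \<in> topspace E" "\<pi> e = pathstart \<gamma>" and \<rho>: "path \<rho>" "pathstart \<rho> = pathfinish \<gamma>"
  shows "transport (\<gamma> +++ \<rho>) e = transport \<rho> (transport \<gamma> e)"
proof -
  let ?\<mu> = "lift (\<gamma> +++ \<rho>) e"
  have j: "path (\<gamma> +++ \<rho>)" "e \<in> topspace E" "\<pi> e = pathstart (\<gamma> +++ \<rho>)"
    using assms by auto
  have "transport ((\<gamma> +++ \<rho>) \<circ> linepath 0 (1/2)) (?\<mu> 0) = ?\<mu> (1/2)"
    using transport_segment[OF j, of 0 "1/2"] by simp
  moreover have "transport ((\<gamma> +++ \<rho>) \<circ> linepath 0 (1/2)) e = transport \<gamma> e"
    using \<gamma> by (intro transport_cong) (auto simp: joinpaths_def linepath_def)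
  moreover have "transport ((\<gamma> +++ \<rho>) \<circ> linepath (1/2) 1) (?\<mu> (1/2)) = ?\<mu> 1"
    using transport_segment[OF j, of "1/2" 1] by simp
  moreover have "transport ((\<gamma> +++ \<rho>) \<circ> linepath (1/2) 1) (transport \<gamma> e) = transport \<rho> (transport \<gamma> e)"
    using \<rho> projection_transport[OF \<gamma>] transport_topspace[OF \<gamma>]
    by (intro transport_cong)
       (auto simp: joinpaths_def linepath_def pathstart_def pathfinish_def field_simps)
  ultimately show ?thesis
    using lift_0[OF j] by (simp add: transport_def)
qed

lemma transport_reversepath:
  assumes \<gamma>: "path \<gamma>" "e \<in> topspace E" "\<pi> e = pathstart \<gamma>"
  shows "transport (reversepath \<gamma>) (transport \<gamma> e) = e"
proof -
  have "\<gamma> \<circ> linepath 1 0 = reversepath \<gamma>"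
    by (auto simp: reversepath_def linepath_def)
  then show ?thesis
    using transport_segment[OF \<gamma>, of 1 0] lift_0[OF \<gamma>] by (simp add: transport_def)
qed

lemma transport_const:
  assumes "e \<in> topspace E" "\<pi> e = x"
  shows "transport (\<lambda>_. x) e = e"
  using transport_equality[of "\<lambda>_. e" "\<lambda>_. x"] assms by (simp add: pathin_const)

lemma transport_local_section:
  assumes s: "local_sections E \<pi> B s" and \<rho>: "path \<rho>" "path_image \<rho> \<subseteq> B"
    and e: "e \<in> topspace E" "\<pi> e = pathstart \<rho>"
  shows "transport \<rho> e = s e (pathfinish \<rho>)"
proof -
  have "\<pi> e \<in> B" using e \<rho> by auto
  note se = local_sectionsD[OF s e(1) this]
  have "continuous_map (top_of_set {0..1}) (top_of_set B) \<rho>"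
    using \<rho> by (auto simp: path_def path_image_def continuous_map_in_subtopology)
  then have "pathin E (s e \<circ> \<rho>)"
    unfolding pathin_def using se(1) continuous_map_compose by blast
  then have "transport \<rho> ((s e \<circ> \<rho>) 0) = (s e \<circ> \<rho>) 1"
  proof (rule transport_equality)
    fix t :: real assume "t \<in> {0..1}"
    then have "\<rho> t \<in> B" using \<rho>(2) by (auto simp: path_image_def)
    then show "\<pi> ((s e \<circ> \<rho>) t) = \<rho> t" using se(4) by simp
  qed
  then show ?thesis
    using se(2) e by (simp add: pathstart_def pathfinish_def)
qed

end

section \<open>Lengths of curves\<close>

fun polygon_length :: "(real \<Rightarrow> 'a::metric_space) \<Rightarrow> real list \<Rightarrow> ennreal" where
  "polygon_length \<gamma> (s # t # ts) = ennreal (dist (\<gamma> s) (\<gamma> t)) + polygon_length \<gamma> (t # ts)"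
| "polygon_length \<gamma> _ = 0"

lemma sum_eq_polygon_length:
  "(\<Sum>i<length ts - 1. ennreal (dist (\<gamma> (ts ! i)) (\<gamma> (ts ! Suc i)))) = polygon_length \<gamma> ts"
  by (induction \<gamma> ts rule: polygon_length.induct) (simp_all add: sum.lessThan_Suc_shift del: sum.lessThan_Suc)

lemma curve_length_eq_Sup_polygon:
  "curve_length \<gamma> = (SUP ts \<in> {ts. sorted ts \<and> set ts \<subseteq> {0..1}}. polygon_length \<gamma> ts)"
  unfolding curve_length_def sum_eq_polygon_length ..

lemma polygon_le_curve_length:
  assumes "sorted ts" "set ts \<subseteq> {0..1}"
  shows "polygon_length \<gamma> ts \<le> curve_length \<gamma>"
  unfolding curve_length_eq_Sup_polygon by (rule SUP_upper) (use assms in auto)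

lemma curve_length_le:
  assumes "\<And>ts. sorted ts \<Longrightarrow> set ts \<subseteq> {0..1} \<Longrightarrow> polygon_length \<gamma> ts \<le> L"
  shows "curve_length \<gamma> \<le> L"
  unfolding curve_length_eq_Sup_polygon by (rule SUP_least) (use assms in auto)

lemma dist_le_curve_length:
  assumes "t \<in> {0..1}"
  shows "ennreal (dist (\<gamma> 0) (\<gamma> t) + dist (\<gamma> t) (\<gamma> 1)) \<le> curve_length \<gamma>"
  using polygon_le_curve_length[of "[0,t,1]" \<gamma>] assms by (simp add: ennreal_plus)

lemma polygon_length_cong:
  "(\<And>t. t \<in> set ts \<Longrightarrow> \<gamma> t = \<gamma>' t) \<Longrightarrow> polygon_length \<gamma> ts = polygon_length \<gamma>' ts"
  by (induction \<gamma> ts rule: polygon_length.induct) auto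

lemma curve_length_cong:
  assumes "\<And>t. t \<in> {0..1} \<Longrightarrow> \<gamma> t = \<gamma>' t"
  shows "curve_length \<gamma> = curve_length \<gamma>'"
  unfolding curve_length_eq_Sup_polygon
  by (rule SUP_cong) (use assms in \<open>auto intro!: polygon_length_cong\<close>)

lemma polygon_length_map: "polygon_length \<gamma> (map \<phi> ts) = polygon_length (\<gamma> \<circ> \<phi>) ts"
  by (induction "\<gamma> \<circ> \<phi>" ts rule: polygon_length.induct) auto

lemma polygon_length_append:
  "polygon_length \<gamma> (xs @ a # ys) = polygon_length \<gamma> (xs @ [a]) + polygon_length \<gamma> (a # ys)"
  by (induction \<gamma> xs rule: polygon_length.induct) (auto simp: add.assoc)

lemma polygon_length_Cons_le: "polygon_length \<gamma> ys \<le> polygon_length \<gamma> (a # ys)"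
  by (cases ys) auto

lemma polygon_length_insert:
  "polygon_length \<gamma> (xs @ ys) \<le> polygon_length \<gamma> (xs @ [a]) + polygon_length \<gamma> (a # ys)"
proof (induction \<gamma> xs rule: polygon_length.induct)
  case (1 \<gamma> s t ts)
  then show ?case by (simp add: add.assoc add_left_mono)
next
  case ("2_1" \<gamma>)
  then show ?case by (simp add: polygon_length_Cons_le)
next
  case ("2_2" \<gamma> x)
  show ?case
  proof (cases ys)
    case (Cons y zs)
    have "ennreal (dist (\<gamma> x) (\<gamma> y)) \<le> ennreal (dist (\<gamma> x) (\<gamma> a)) + ennreal (dist (\<gamma> a) (\<gamma> y))"
      by (simp add: dist_triangle ennreal_leI flip: ennreal_plus)
    from add_right_mono[OF this, of "polygon_length \<gamma> (y # zs)"] show ?thesis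
      by (simp add: Cons add.assoc)
  qed simp
qed

lemma polygon_length_rev: "polygon_length \<gamma> (rev ts) = polygon_length \<gamma> ts"
proof (induction \<gamma> ts rule: polygon_length.induct)
  case (1 \<gamma> s t ts)
  then show ?case
    using polygon_length_append[of \<gamma> "rev ts" t "[s]"] by (simp add: add.commute dist_commute)
qed auto

lemma curve_length_reversepath_le: "curve_length (reversepath \<gamma>) \<le> curve_length \<gamma>"
proof (rule curve_length_le)
  fix ts :: "real list" assume ts: "sorted ts" "set ts \<subseteq> {0..1}"
  have "sorted (map (\<lambda>t. 1 - t) (rev ts))"
    using ts(1) by (induction ts) (auto simp: sorted_append)
  then have "polygon_length \<gamma> (map (\<lambda>t. 1 - t) (rev ts)) \<le> curve_length \<gamma>"
    by (rule polygon_le_curve_length) (use ts in auto)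
  then show "polygon_length (reversepath \<gamma>) ts \<le> curve_length \<gamma>"
    by (simp add: polygon_length_map polygon_length_rev reversepath_def o_def)
qed

lemma sorted_split_filter:
  fixes ts :: "'a::linorder list"
  assumes "sorted ts"
  shows "filter (\<lambda>t. t \<le> c) ts @ filter (\<lambda>t. \<not> t \<le> c) ts = ts"
  using assms
proof (induction ts)
  case (Cons t ts)
  show ?case
  proof (cases "t \<le> c")
    case False
    then have "\<not> u \<le> c" if "u \<in> set ts" for u
      using Cons.prems that by (meson order_trans sorted_simps(2))
    then have "filter (\<lambda>t. t \<le> c) ts = []" "filter (\<lambda>t. \<not> t \<le> c) ts = ts"
      by (simp_all add: filter_empty_conv filter_id_conv)
    with False show ?thesis by simp
  qed (use Cons in simp)
qed simp

lemma curve_length_join_le: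
  assumes "pathfinish \<gamma> = pathstart \<rho>"
  shows "curve_length (\<gamma> +++ \<rho>) \<le> curve_length \<gamma> + curve_length \<rho>"
proof (rule curve_length_le)
  fix ts :: "real list" assume ts: "sorted ts" "set ts \<subseteq> {0..1}"
  define xs ys where "xs = filter (\<lambda>t. t \<le> 1/2) ts" and "ys = filter (\<lambda>t. \<not> t \<le> 1/2) ts"
  have xs: "sorted (map ((*) 2) (xs @ [1/2]))" "set (map ((*) 2) (xs @ [1/2])) \<subseteq> {0..1}"
    using ts unfolding xs_def by (auto simp: sorted_append sorted_map sorted_wrt_filter)
  have ys: "sorted (map (\<lambda>t. 2 * t - 1) (1/2 # ys))" "set (map (\<lambda>t. 2 * t - 1) (1/2 # ys)) \<subseteq> {0..1}"
    using ts unfolding ys_def by (auto simp: sorted_map sorted_wrt_filter)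
  have "polygon_length (\<gamma> +++ \<rho>) ts = polygon_length (\<gamma> +++ \<rho>) (xs @ ys)"
    unfolding xs_def ys_def sorted_split_filter[OF ts(1)] ..
  also have "\<dots> \<le> polygon_length (\<gamma> +++ \<rho>) (xs @ [1/2]) + polygon_length (\<gamma> +++ \<rho>) (1/2 # ys)"
    by (rule polygon_length_insert)
  also have "polygon_length (\<gamma> +++ \<rho>) (xs @ [1/2]) = polygon_length \<gamma> (map ((*) 2) (xs @ [1/2]))"
    unfolding polygon_length_map
    by (rule polygon_length_cong) (auto simp: joinpaths_def xs_def)
  also have "\<dots> \<le> curve_length \<gamma>"
    using xs by (rule polygon_le_curve_length)
  also have "polygon_length (\<gamma> +++ \<rho>) (1/2 # ys) = polygon_length \<rho> (map (\<lambda>t. 2 * t - 1) (1/2 # ys))"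
    unfolding polygon_length_map
  proof (rule polygon_length_cong)
    fix t assume "t \<in> set (1/2 # ys)"
    then consider "t = 1/2" | "\<not> t \<le> 1/2" by (auto simp: ys_def)
    then show "(\<gamma> +++ \<rho>) t = (\<rho> \<circ> (\<lambda>t. 2 * t - 1)) t"
    proof cases
      case 1
      have "(\<gamma> +++ \<rho>) (1/2) = \<rho> (2 * (1/2) - 1)"
        using assms by (simp add: joinpaths_def pathstart_def pathfinish_def)
      then show ?thesis by (simp only: 1 o_def)
    qed (simp add: joinpaths_def)
  qed
  also have "\<dots> \<le> curve_length \<rho>"
    using ys by (rule polygon_le_curve_length)
  finally show "polygon_length (\<gamma> +++ \<rho>) ts \<le> curve_length \<gamma> + curve_length \<rho>"
    by (simp add: add_mono)
qed

text \<open>Points of a curve of length \<open>dist x y\<close> are no farther from \<open>x\<close> than \<open>y\<close>, so balls of a length space are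
path connected by minimizing curves.\<close>

lemma length_space_geodesic:
  fixes x y :: "'a::metric_space"
  assumes "length_space TYPE('a)"
  obtains \<gamma> where "path \<gamma>" "pathstart \<gamma> = x" "pathfinish \<gamma> = y" "curve_length \<gamma> = ennreal (dist x y)"
    "\<And>r. dist x y < r \<Longrightarrow> path_image \<gamma> \<subseteq> ball x r"
proof -
  obtain \<gamma> where \<gamma>: "path \<gamma>" "pathstart \<gamma> = x" "pathfinish \<gamma> = y" "curve_length \<gamma> = ennreal (dist x y)"
    using assms unfolding length_space_def by metis
  have "dist x (\<gamma> t) \<le> dist x y" if "t \<in> {0..1}" for t
  proof -
    have "ennreal (dist (\<gamma> 0) (\<gamma> t) + dist (\<gamma> t) (\<gamma> 1)) \<le> ennreal (dist x y)"
      using dist_le_curve_length[OF that, of \<gamma>] \<gamma>(4) by simp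
    then have "dist (\<gamma> 0) (\<gamma> t) + dist (\<gamma> t) (\<gamma> 1) \<le> dist x y"
      by (subst (asm) ennreal_le_iff) auto
    then have "dist (\<gamma> 0) (\<gamma> t) \<le> dist x y"
      using zero_le_dist[of "\<gamma> t" "\<gamma> 1"] by linarith
    then show ?thesis
      using \<gamma>(2) by (simp add: pathstart_def)
  qed
  then show thesis
    using that[OF \<gamma>] by (fastforce simp: path_image_def)
qed

section \<open>The fundamental group\<close>

abbreviation homotopic :: "(real \<Rightarrow> 'a::topological_space) \<Rightarrow> (real \<Rightarrow> 'a) \<Rightarrow> bool" where
  "homotopic \<equiv> homotopic_paths UNIV"

text \<open>The parameter interval is convex. The groupoid laws for paths in an arbitrary metric space
are all instances of this.\<close>

lemma homotopic_reparametrizations: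
  fixes \<gamma> :: "real \<Rightarrow> 'a::metric_space"
  assumes \<gamma>: "path \<gamma>" and "path \<phi>" "path \<psi>" "path_image \<phi> \<subseteq> {0..1}" "path_image \<psi> \<subseteq> {0..1}"
    "pathstart \<phi> = pathstart \<psi>" "pathfinish \<phi> = pathfinish \<psi>"
  shows "homotopic (\<gamma> \<circ> \<phi>) (\<gamma> \<circ> \<psi>)"
proof -
  have "homotopic_paths {0..1} \<phi> \<psi>"
  proof (rule homotopic_paths_linear)
    fix t :: real assume "t \<in> {0..1}"
    then have "\<phi> t \<in> {0..1}" "\<psi> t \<in> {0..1}"
      using assms(4,5) unfolding path_image_def by blast+
    then show "closed_segment (\<phi> t) (\<psi> t) \<subseteq> {0..1}"
      by (simp add: closed_segment_subset)
  qed (use assms in simp_all)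
  then show ?thesis
    by (rule homotopic_paths_continuous_image) (use \<gamma> in \<open>auto simp: path_def\<close>)
qed

lemma path_const: "path (\<lambda>_. x)" "pathstart (\<lambda>_. x) = x" "pathfinish (\<lambda>_. x) = x"
  by (simp_all add: path_def pathstart_def pathfinish_def)

lemma homotopic_cong_left:
  "homotopic a a' \<Longrightarrow> path b \<Longrightarrow> pathfinish a = pathstart b \<Longrightarrow> homotopic (a +++ b) (a' +++ b)"
  by (rule homotopic_paths_join) auto

lemma homotopic_cong_right:
  "homotopic b b' \<Longrightarrow> path a \<Longrightarrow> pathfinish a = pathstart b \<Longrightarrow> homotopic (a +++ b) (a +++ b')"
  by (rule homotopic_paths_join) auto

lemma homotopic_assoc:
  "path a \<Longrightarrow> path b \<Longrightarrow> path c \<Longrightarrow> pathfinish a = pathstart b \<Longrightarrow> pathfinish b = pathstart c \<Longrightarrow>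
    homotopic ((a +++ b) +++ c) (a +++ (b +++ c))"
  by (rule homotopic_paths_sym, rule homotopic_paths_assoc) auto

lemma homotopic_segments:
  fixes \<gamma> :: "real \<Rightarrow> 'a::metric_space"
  assumes "path \<gamma>" "r \<in> {0..1}" "s \<in> {0..1}" "t \<in> {0..1}"
  shows "homotopic ((\<gamma> \<circ> linepath r s) +++ (\<gamma> \<circ> linepath s t)) (\<gamma> \<circ> linepath r t)"
proof -
  have "homotopic (\<gamma> \<circ> (linepath r s +++ linepath s t)) (\<gamma> \<circ> linepath r t)"
    using assms
    by (intro homotopic_reparametrizations) (auto simp: path_image_join closed_segment_eq_real_ivl split: if_splits)
  then show ?thesis
    by (simp add: path_compose_join)
qed

lemma homotopic_reverse_right:
  fixes \<gamma> :: "real \<Rightarrow> 'a::metric_space"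
  assumes "path \<gamma>" shows "homotopic (\<gamma> +++ reversepath \<gamma>) (\<lambda>_. pathstart \<gamma>)"
proof -
  have "\<gamma> \<circ> linepath 0 1 = \<gamma>" "\<gamma> \<circ> linepath 1 0 = reversepath \<gamma>" "\<gamma> \<circ> linepath 0 0 = (\<lambda>_. pathstart \<gamma>)"
    by (auto simp: linepath_def reversepath_def pathstart_def)
  then show ?thesis
    using homotopic_segments[OF assms, of 0 1 0] by simp
qed

lemma homotopic_unit_right:
  fixes \<gamma> :: "real \<Rightarrow> 'a::metric_space"
  assumes "path \<gamma>" "pathfinish \<gamma> = x" shows "homotopic (\<gamma> +++ (\<lambda>_. x)) \<gamma>"
proof -
  have "\<gamma> \<circ> linepath 0 1 = \<gamma>" "\<gamma> \<circ> linepath 1 1 = (\<lambda>_. x)"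
    using assms(2) by (auto simp: linepath_def pathfinish_def)
  then show ?thesis
    using homotopic_segments[OF assms(1), of 0 1 1] by simp
qed

lemma homotopic_unit_left:
  fixes \<gamma> :: "real \<Rightarrow> 'a::metric_space"
  assumes "path \<gamma>" "pathstart \<gamma> = x" shows "homotopic ((\<lambda>_. x) +++ \<gamma>) \<gamma>"
proof -
  have "\<gamma> \<circ> linepath 0 1 = \<gamma>" "\<gamma> \<circ> linepath 0 0 = (\<lambda>_. x)"
    using assms(2) by (auto simp: linepath_def pathstart_def)
  then show ?thesis
    using homotopic_segments[OF assms(1), of 0 0 1] by simp
qed

lemma homotopic_cancel:
  fixes a :: "real \<Rightarrow> 'a::metric_space"
  assumes "path a" "path c" "pathfinish a = pathstart c"
  shows "homotopic ((a +++ c) +++ reversepath c) a"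
proof -
  have "homotopic ((a +++ c) +++ reversepath c) (a +++ (c +++ reversepath c))"
    using assms by (intro homotopic_assoc) auto
  also have "homotopic \<dots> (a +++ (\<lambda>_. pathfinish a))"
    using homotopic_reverse_right[OF assms(2)] assms by (intro homotopic_cong_right) auto
  also have "homotopic \<dots> a"
    using assms by (intro homotopic_unit_right) auto
  finally show ?thesis .
qed

lemma homotopic_cancel_middle:
  fixes a :: "real \<Rightarrow> 'a::metric_space"
  assumes "path a" "path b" "path c" "pathfinish a = pathstart c" "pathfinish a = pathstart b"
  shows "homotopic ((a +++ c) +++ (reversepath c +++ b)) (a +++ b)"
proof -
  have "homotopic (((a +++ c) +++ reversepath c) +++ b) ((a +++ c) +++ (reversepath c +++ b))"
    using assms by (intro homotopic_assoc) auto
  moreover have "homotopic (((a +++ c) +++ reversepath c) +++ b) (a +++ b)"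
    using assms by (intro homotopic_cong_left homotopic_cancel) auto
  ultimately show ?thesis
    using homotopic_paths_trans homotopic_paths_sym by blast
qed

lemma path_class_eqI: "homotopic a b \<Longrightarrow> path_class a = path_class b"
  unfolding path_class_def using homotopic_paths_trans homotopic_paths_sym by blast

lemma path_class_cong:
  assumes "path \<gamma>" "\<And>t. t \<in> {0..1} \<Longrightarrow> \<gamma> t = \<gamma>' t"
  shows "path_class \<gamma> = path_class \<gamma>'"
  by (rule path_class_eqI, rule homotopic_paths_eq) (use assms in auto)

lemma path_class_loopI:
  "path \<gamma> \<Longrightarrow> pathstart \<gamma> = p \<Longrightarrow> pathfinish \<gamma> = p \<Longrightarrow> path_class \<gamma> \<in> carrier (fundamental_group p)"
  by (auto simp: fundamental_group_def)

lemma path_class_loopE: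
  assumes "g \<in> carrier (fundamental_group p)"
  obtains \<gamma> where "g = path_class \<gamma>" "path \<gamma>" "pathstart \<gamma> = p" "pathfinish \<gamma> = p"
  using assms by (auto simp: fundamental_group_def)

lemma mult_path_class:
  assumes "path a" "path b" "pathfinish a = pathstart b"
  shows "path_class a \<otimes>\<^bsub>fundamental_group p\<^esub> path_class b = path_class (a +++ b)"
proof -
  have "path_class (\<alpha> +++ \<beta>) = path_class (a +++ b)" if "\<alpha> \<in> path_class a" "\<beta> \<in> path_class b" for \<alpha> \<beta>
  proof -
    have "homotopic (a +++ b) (\<alpha> +++ \<beta>)"
      using that assms(3) by (intro homotopic_paths_join) (auto simp: path_class_def)
    then show ?thesis
      using path_class_eqI by metis
  qed
  moreover have "a \<in> path_class a" "b \<in> path_class b"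
    using assms by (simp_all add: path_class_def)
  ultimately have "(\<Union>\<alpha>\<in>path_class a. \<Union>\<beta>\<in>path_class b. path_class (\<alpha> +++ \<beta>)) = path_class (a +++ b)"
    by blast
  then show ?thesis
    by (simp add: fundamental_group_def)
qed

lemma one_fundamental_group: "\<one>\<^bsub>fundamental_group p\<^esub> = path_class (\<lambda>_. p)"
  by (simp add: fundamental_group_def)

lemma reverse_mult_path_class:
  fixes a :: "real \<Rightarrow> 'a::metric_space"
  assumes "path a" "pathstart a = p" "pathfinish a = p"
  shows "path_class (reversepath a) \<otimes>\<^bsub>fundamental_group p\<^esub> path_class a = \<one>\<^bsub>fundamental_group p\<^esub>"
  using assms homotopic_reverse_right[of "reversepath a"]
  by (simp add: mult_path_class one_fundamental_group path_class_eqI)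

lemma group_fundamental_group: "group (fundamental_group (p :: 'a::metric_space))"
proof (rule groupI)
  show "\<one>\<^bsub>fundamental_group p\<^esub> \<in> carrier (fundamental_group p)"
    unfolding one_fundamental_group by (rule path_class_loopI) (simp_all add: path_const)
next
  fix x y assume "x \<in> carrier (fundamental_group p)" "y \<in> carrier (fundamental_group p)"
  then show "x \<otimes>\<^bsub>fundamental_group p\<^esub> y \<in> carrier (fundamental_group p)"
    by (elim path_class_loopE) (simp add: mult_path_class path_class_loopI)
next
  fix x y z assume "x \<in> carrier (fundamental_group p)" "y \<in> carrier (fundamental_group p)"
    "z \<in> carrier (fundamental_group p)"
  then show "x \<otimes>\<^bsub>fundamental_group p\<^esub> y \<otimes>\<^bsub>fundamental_group p\<^esub> z =
      x \<otimes>\<^bsub>fundamental_group p\<^esub> (y \<otimes>\<^bsub>fundamental_group p\<^esub> z)"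
    by (elim path_class_loopE) (simp add: mult_path_class path_class_eqI homotopic_assoc)
next
  fix x assume "x \<in> carrier (fundamental_group p)"
  then show "\<one>\<^bsub>fundamental_group p\<^esub> \<otimes>\<^bsub>fundamental_group p\<^esub> x = x"
    by (elim path_class_loopE)
       (simp add: one_fundamental_group mult_path_class path_const path_class_eqI homotopic_unit_left)
next
  fix x assume "x \<in> carrier (fundamental_group p)"
  then obtain a where a: "x = path_class a" "path a" "pathstart a = p" "pathfinish a = p"
    by (rule path_class_loopE)
  then show "\<exists>y\<in>carrier (fundamental_group p). y \<otimes>\<^bsub>fundamental_group p\<^esub> x = \<one>\<^bsub>fundamental_group p\<^esub>"
    by (intro bexI[of _ "path_class (reversepath a)"]) (simp_all add: reverse_mult_path_class path_class_loopI)
qed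

lemma inv_path_class:
  fixes a :: "real \<Rightarrow> 'a::metric_space"
  assumes "path a" "pathstart a = p" "pathfinish a = p"
  shows "inv\<^bsub>fundamental_group p\<^esub> (path_class a) = path_class (reversepath a)"
  by (rule group.inv_equality[OF group_fundamental_group reverse_mult_path_class[OF assms]])
     (use assms in \<open>auto intro: path_class_loopI\<close>)

lemma cutoff_generators_subset:
  "cutoff_generators p \<delta> R \<subseteq> carrier (fundamental_group p)"
  by (auto simp: cutoff_generators_def intro!: path_class_loopI)

section \<open>The covering space of a congruence of paths\<close>

lemma path_segment:
  fixes \<gamma> :: "real \<Rightarrow> 'a::metric_space"
  assumes "path \<gamma>" "s \<in> {0..1}" "t \<in> {0..1}"
  shows "path (\<gamma> \<circ> linepath s t)" "path_image (\<gamma> \<circ> linepath s t) = \<gamma> ` closed_segment s t"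
    "pathstart (\<gamma> \<circ> linepath s t) = \<gamma> s" "pathfinish (\<gamma> \<circ> linepath s t) = \<gamma> t"
proof -
  have "closed_segment s t \<subseteq> {0..1}"
    using assms by (simp add: closed_segment_subset)
  then show "path (\<gamma> \<circ> linepath s t)"
    using assms(1) by (intro path_continuous_image) (auto simp: path_def intro: continuous_on_subset)
qed (auto simp: path_image_compose pathstart_compose pathfinish_compose)

text \<open>The usual construction of covering spaces from classes of paths, with homotopy replaced by an
abstract relation. The laws allow paths to be extended and retraced, and \<open>locally_trivial\<close> makes
small balls evenly covered. They are phrased so that they can be verified both for a relation
defined by homotopy and for one defined by lifting paths to a given cover.\<close>

locale path_congruence =
  fixes b :: "'a::metric_space" and rel :: "(real \<Rightarrow> 'a) \<Rightarrow> (real \<Rightarrow> 'a) \<Rightarrow> bool" (infix \<open>\<asymp>\<close> 50)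
  assumes length_space: "length_space TYPE('a)"
    and relD: "\<gamma> \<asymp> \<gamma>' \<Longrightarrow> path \<gamma> \<and> pathstart \<gamma> = b \<and> path \<gamma>' \<and> pathstart \<gamma>' = b \<and> pathfinish \<gamma> = pathfinish \<gamma>'"
    and refl: "path \<gamma> \<Longrightarrow> pathstart \<gamma> = b \<Longrightarrow> \<gamma> \<asymp> \<gamma>"
    and sym: "\<gamma> \<asymp> \<gamma>' \<Longrightarrow> \<gamma>' \<asymp> \<gamma>"
    and trans: "\<gamma> \<asymp> \<gamma>' \<Longrightarrow> \<gamma>' \<asymp> \<gamma>'' \<Longrightarrow> \<gamma> \<asymp> \<gamma>''"
    and cong: "\<gamma> \<asymp> \<gamma>' \<Longrightarrow> path \<rho> \<Longrightarrow> pathstart \<rho> = pathfinish \<gamma> \<Longrightarrow> \<gamma> +++ \<rho> \<asymp> \<gamma>' +++ \<rho>"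
    and assoc: "path \<gamma> \<Longrightarrow> pathstart \<gamma> = b \<Longrightarrow> path \<rho> \<Longrightarrow> path \<rho>' \<Longrightarrow> pathstart \<rho> = pathfinish \<gamma> \<Longrightarrow>
      pathstart \<rho>' = pathfinish \<rho> \<Longrightarrow> (\<gamma> +++ \<rho>) +++ \<rho>' \<asymp> \<gamma> +++ (\<rho> +++ \<rho>')"
    and cancel: "path \<gamma> \<Longrightarrow> pathstart \<gamma> = b \<Longrightarrow> path \<rho> \<Longrightarrow> pathstart \<rho> = pathfinish \<gamma> \<Longrightarrow>
      (\<gamma> +++ \<rho>) +++ reversepath \<rho> \<asymp> \<gamma>"
    and segments: "path \<gamma> \<Longrightarrow> pathstart \<gamma> = b \<Longrightarrow> path \<rho> \<Longrightarrow> pathstart \<rho> = pathfinish \<gamma> \<Longrightarrow>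
      s \<in> {0..1} \<Longrightarrow> t \<in> {0..1} \<Longrightarrow>
      (\<gamma> +++ (\<rho> \<circ> linepath 0 s)) +++ (\<rho> \<circ> linepath s t) \<asymp> \<gamma> +++ (\<rho> \<circ> linepath 0 t)"
    and unit_right: "path \<gamma> \<Longrightarrow> pathstart \<gamma> = b \<Longrightarrow> \<gamma> +++ (\<lambda>_. pathfinish \<gamma>) \<asymp> \<gamma>"
    and unit_left: "path \<gamma> \<Longrightarrow> pathstart \<gamma> = b \<Longrightarrow> (\<lambda>_. b) +++ \<gamma> \<asymp> \<gamma>"
    and locally_trivial: "\<exists>r>0. \<forall>\<gamma> \<rho> \<rho>'. path \<gamma> \<and> pathstart \<gamma> = b \<and> path \<rho> \<and> path \<rho>' \<and>
      pathstart \<rho> = pathfinish \<gamma> \<and> pathstart \<rho>' = pathfinish \<gamma> \<and> pathfinish \<rho> = pathfinish \<rho>' \<and>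
      path_image \<rho> \<subseteq> ball x r \<and> path_image \<rho>' \<subseteq> ball x r \<longrightarrow> \<gamma> +++ \<rho> \<asymp> \<gamma> +++ \<rho>'"
begin

definition cls :: "(real \<Rightarrow> 'a) \<Rightarrow> (real \<Rightarrow> 'a) set" where
  "cls \<gamma> = {\<gamma>'. \<gamma> \<asymp> \<gamma>'}"

definition based :: "(real \<Rightarrow> 'a) \<Rightarrow> bool" where
  "based \<gamma> \<longleftrightarrow> path \<gamma> \<and> pathstart \<gamma> = b"

definition endpoint :: "(real \<Rightarrow> 'a) set \<Rightarrow> 'a" where
  "endpoint C = pathfinish (SOME \<gamma>. \<gamma> \<in> C)"

definition sheet :: "(real \<Rightarrow> 'a) \<Rightarrow> real \<Rightarrow> (real \<Rightarrow> 'a) set set" where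
  "sheet \<gamma> r = {cls (\<gamma> +++ \<rho>) |\<rho>.
     path \<rho> \<and> pathstart \<rho> = pathfinish \<gamma> \<and> path_image \<rho> \<subseteq> ball (pathfinish \<gamma>) r}"

text \<open>The basic neighbourhoods of the class of \<open>\<gamma>\<close> are the sets \<open>sheet \<gamma> r\<close> of its extensions inside balls.\<close>

definition cover :: "(real \<Rightarrow> 'a) set topology" where
  "cover = topology (\<lambda>V. V \<subseteq> cls ` Collect based \<and>
     (\<forall>\<gamma>. based \<gamma> \<and> cls \<gamma> \<in> V \<longrightarrow> (\<exists>r>0. sheet \<gamma> r \<subseteq> V)))"

lemma based_join: "based \<gamma> \<Longrightarrow> path \<rho> \<Longrightarrow> pathstart \<rho> = pathfinish \<gamma> \<Longrightarrow> based (\<gamma> +++ \<rho>)"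
  by (simp add: based_def)

lemma cls_eq_iff: "based \<gamma>' \<Longrightarrow> cls \<gamma> = cls \<gamma>' \<longleftrightarrow> \<gamma> \<asymp> \<gamma>'"
  unfolding cls_def based_def using refl sym trans by blast

lemma endpoint_cls:
  assumes "based \<gamma>" shows "endpoint (cls \<gamma>) = pathfinish \<gamma>"
proof -
  have "\<gamma> \<in> cls \<gamma>"
    using assms refl by (simp add: cls_def based_def)
  then have "(SOME \<gamma>'. \<gamma>' \<in> cls \<gamma>) \<in> cls \<gamma>"
    by (rule someI[of "\<lambda>\<gamma>'. \<gamma>' \<in> cls \<gamma>"])
  then show ?thesis
    unfolding endpoint_def using relD by (simp add: cls_def)
qed

lemma sheet_mono: "r \<le> r' \<Longrightarrow> sheet \<gamma> r \<subseteq> sheet \<gamma> r'"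
  unfolding sheet_def using subset_ball[of r r' "pathfinish \<gamma>"] by blast

lemma sheet_subset: "based \<gamma> \<Longrightarrow> sheet \<gamma> r \<subseteq> cls ` Collect based"
  unfolding sheet_def using based_join by blast

lemma openin_cover:
  "openin cover V \<longleftrightarrow> V \<subseteq> cls ` Collect based \<and>
     (\<forall>\<gamma>. based \<gamma> \<and> cls \<gamma> \<in> V \<longrightarrow> (\<exists>r>0. sheet \<gamma> r \<subseteq> V))"
proof -
  let ?P = "\<lambda>V. V \<subseteq> cls ` Collect based \<and> (\<forall>\<gamma>. based \<gamma> \<and> cls \<gamma> \<in> V \<longrightarrow> (\<exists>r>0. sheet \<gamma> r \<subseteq> V))"
  have "istopology ?P"
    unfolding istopology_def
  proof (intro conjI allI impI)
    fix S T \<gamma> assume S: "?P S" and T: "?P T" and \<gamma>: "based \<gamma> \<and> cls \<gamma> \<in> S \<inter> T"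
    obtain r where r: "r > 0" "sheet \<gamma> r \<subseteq> S"
      using S \<gamma> by blast
    obtain r' where r': "r' > 0" "sheet \<gamma> r' \<subseteq> T"
      using T \<gamma> by blast
    have "sheet \<gamma> (min r r') \<subseteq> S \<inter> T" "min r r' > 0"
      using r r' sheet_mono[of "min r r'" r \<gamma>] sheet_mono[of "min r r'" r' \<gamma>] by auto
    then show "\<exists>r>0. sheet \<gamma> r \<subseteq> S \<inter> T" by blast
  next
    fix \<K> \<gamma> assume \<K>: "\<forall>V\<in>\<K>. ?P V" and "based \<gamma> \<and> cls \<gamma> \<in> \<Union>\<K>"
    then obtain V where V: "V \<in> \<K>" "based \<gamma> \<and> cls \<gamma> \<in> V" by blast
    then obtain r where "r > 0" "sheet \<gamma> r \<subseteq> V" using \<K> by blast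
    then show "\<exists>r>0. sheet \<gamma> r \<subseteq> \<Union>\<K>" using V(1) by blast
  qed blast+
  then show ?thesis
    unfolding cover_def by (simp add: topology_inverse')
qed

lemma topspace_cover: "topspace cover = cls ` Collect based"
proof
  have "openin cover (cls ` Collect based)"
    unfolding openin_cover using sheet_subset zero_less_one by blast
  then show "cls ` Collect based \<subseteq> topspace cover"
    by (rule openin_subset)
  show "topspace cover \<subseteq> cls ` Collect based"
    using openin_cover[of "topspace cover"] by simp
qed

lemma openin_sheet:
  assumes \<gamma>: "based \<gamma>" shows "openin cover (sheet \<gamma> r)"
  unfolding openin_cover
proof (intro conjI allI impI sheet_subset[OF \<gamma>])
  fix \<gamma>' assume \<gamma>': "based \<gamma>' \<and> cls \<gamma>' \<in> sheet \<gamma> r"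
  then obtain \<rho> where \<rho>: "path \<rho>" "pathstart \<rho> = pathfinish \<gamma>" "path_image \<rho> \<subseteq> ball (pathfinish \<gamma>) r"
    and eq: "cls \<gamma>' = cls (\<gamma> +++ \<rho>)"
    unfolding sheet_def by blast
  have rel: "\<gamma>' \<asymp> \<gamma> +++ \<rho>"
    using eq cls_eq_iff[OF based_join[OF \<gamma> \<rho>(1,2)]] by simp
  then have fin: "pathfinish \<gamma>' = pathfinish \<rho>"
    using relD by fastforce
  define s where "s = r - dist (pathfinish \<gamma>) (pathfinish \<rho>)"
  have "pathfinish \<rho> \<in> ball (pathfinish \<gamma>) r"
    using \<rho>(3) by auto
  then have "s > 0" by (simp add: s_def)
  have sub: "ball (pathfinish \<rho>) s \<subseteq> ball (pathfinish \<gamma>) r"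
    unfolding s_def by (simp add: subset_iff) (smt (verit) dist_triangle)
  have "sheet \<gamma>' s \<subseteq> sheet \<gamma> r"
  proof
    fix C assume "C \<in> sheet \<gamma>' s"
    then obtain \<rho>' where \<rho>': "path \<rho>'" "pathstart \<rho>' = pathfinish \<rho>" "path_image \<rho>' \<subseteq> ball (pathfinish \<rho>) s"
      and C: "C = cls (\<gamma>' +++ \<rho>')"
      unfolding sheet_def fin by blast
    have "\<gamma>' +++ \<rho>' \<asymp> (\<gamma> +++ \<rho>) +++ \<rho>'"
      using cong[OF rel] \<rho>' fin by simp
    moreover have "(\<gamma> +++ \<rho>) +++ \<rho>' \<asymp> \<gamma> +++ (\<rho> +++ \<rho>')"
      using \<gamma> \<rho> \<rho>' by (intro assoc) (auto simp: based_def)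
    ultimately have "\<gamma>' +++ \<rho>' \<asymp> \<gamma> +++ (\<rho> +++ \<rho>')"
      by (rule trans)
    moreover have "based (\<gamma> +++ (\<rho> +++ \<rho>'))"
      using \<gamma> \<rho> \<rho>' by (simp add: based_join)
    ultimately have "C = cls (\<gamma> +++ (\<rho> +++ \<rho>'))"
      unfolding C by (simp add: cls_eq_iff)
    moreover have "path_image (\<rho> +++ \<rho>') \<subseteq> ball (pathfinish \<gamma>) r"
      using \<rho> \<rho>' sub by (auto simp: path_image_join)
    ultimately show "C \<in> sheet \<gamma> r"
      unfolding sheet_def using \<rho> \<rho>'
      by (intro CollectI exI[of _ "\<rho> +++ \<rho>'"]) simp
  qed
  with \<open>s > 0\<close> show "\<exists>s>0. sheet \<gamma>' s \<subseteq> sheet \<gamma> r" by blast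
qed

lemma endpoint_sheet:
  assumes \<gamma>: "based \<gamma>" shows "endpoint ` sheet \<gamma> r = ball (pathfinish \<gamma>) r"
proof
  show "endpoint ` sheet \<gamma> r \<subseteq> ball (pathfinish \<gamma>) r"
  proof
    fix y assume "y \<in> endpoint ` sheet \<gamma> r"
    then obtain \<rho> where \<rho>: "path \<rho>" "pathstart \<rho> = pathfinish \<gamma>" "path_image \<rho> \<subseteq> ball (pathfinish \<gamma>) r"
      and "y = endpoint (cls (\<gamma> +++ \<rho>))"
      unfolding sheet_def by blast
    then have "y = pathfinish \<rho>"
      using endpoint_cls[OF based_join[OF \<gamma>]] by simp
    with \<rho>(3) show "y \<in> ball (pathfinish \<gamma>) r"
      by auto
  qed
  show "ball (pathfinish \<gamma>) r \<subseteq> endpoint ` sheet \<gamma> r"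
  proof
    fix y assume "y \<in> ball (pathfinish \<gamma>) r"
    then obtain \<rho> where \<rho>: "path \<rho>" "pathstart \<rho> = pathfinish \<gamma>" "pathfinish \<rho> = y"
      "path_image \<rho> \<subseteq> ball (pathfinish \<gamma>) r"
      using length_space_geodesic[OF length_space, of "pathfinish \<gamma>" y] by (metis mem_ball)
    then have "cls (\<gamma> +++ \<rho>) \<in> sheet \<gamma> r"
      unfolding sheet_def by blast
    moreover have "endpoint (cls (\<gamma> +++ \<rho>)) = y"
      using endpoint_cls[OF based_join[OF \<gamma> \<rho>(1,2)]] \<rho>(3) by simp
    ultimately show "y \<in> endpoint ` sheet \<gamma> r"
      by blast
  qed
qed

lemma continuous_map_endpoint: "continuous_map cover euclidean endpoint"
  unfolding continuous_map
proof (intro conjI allI impI)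
  fix U assume "openin euclidean (U :: 'a set)"
  then have U: "open U" by simp
  show "openin cover {C \<in> topspace cover. endpoint C \<in> U}"
    unfolding openin_cover
  proof (intro conjI allI impI)
    fix \<gamma> assume \<gamma>: "based \<gamma> \<and> cls \<gamma> \<in> {C \<in> topspace cover. endpoint C \<in> U}"
    then have "pathfinish \<gamma> \<in> U"
      using endpoint_cls by auto
    then obtain r where "r > 0" "ball (pathfinish \<gamma>) r \<subseteq> U"
      using U open_contains_ball by blast
    moreover from this have "sheet \<gamma> r \<subseteq> {C \<in> topspace cover. endpoint C \<in> U}"
      using \<gamma> endpoint_sheet[of \<gamma> r] sheet_subset[of \<gamma> r] by (auto simp: topspace_cover)
    ultimately show "\<exists>r>0. sheet \<gamma> r \<subseteq> {C \<in> topspace cover. endpoint C \<in> U}"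
      by blast
  qed (auto simp: topspace_cover)
qed simp

lemma open_map_endpoint: "open_map cover euclidean endpoint"
  unfolding open_map_def
proof (intro allI impI)
  fix V assume V: "openin cover V"
  have "open (endpoint ` V)"
    unfolding open_contains_ball
  proof
    fix y assume "y \<in> endpoint ` V"
    then obtain \<gamma> where \<gamma>: "based \<gamma>" "cls \<gamma> \<in> V" "y = pathfinish \<gamma>"
      using V endpoint_cls unfolding openin_cover by blast
    then obtain r where "r > 0" "sheet \<gamma> r \<subseteq> V"
      using V unfolding openin_cover by blast
    then show "\<exists>r>0. ball y r \<subseteq> endpoint ` V"
      using endpoint_sheet[OF \<gamma>(1), of r] \<gamma>(3) by blast
  qed
  then show "openin euclidean (endpoint ` V)" by simp
qed

lemma rel_of_cls_eq:
  assumes "cls \<gamma> = cls \<gamma>'" "based \<gamma>'" shows "\<gamma> \<asymp> \<gamma>'"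
  using assms cls_eq_iff by blast

text \<open>Over a ball on which the congruence is trivial, two sheets with a common point coincide: if
\<open>\<gamma> +++ \<rho> \<asymp> \<gamma>' +++ \<rho>'\<close>, then \<open>\<rho>'\<close> may be replaced by \<open>\<rho>\<close> and cancelled.\<close>

lemma evenly_covered:
  fixes x :: 'a
  obtains r where "r > 0"
    "\<Union>{sheet \<gamma> r |\<gamma>. based \<gamma> \<and> pathfinish \<gamma> = x} = {C \<in> topspace cover. endpoint C \<in> ball x r}"
    "pairwise disjnt {sheet \<gamma> r |\<gamma>. based \<gamma> \<and> pathfinish \<gamma> = x}"
    "\<And>\<gamma>. based \<gamma> \<Longrightarrow> pathfinish \<gamma> = x \<Longrightarrow> inj_on endpoint (sheet \<gamma> r)"
proof -
  obtain r where r: "r > 0" and loc: "\<And>\<gamma> \<rho> \<rho>'. \<lbrakk>based \<gamma>; path \<rho>; path \<rho>'; pathstart \<rho> = pathfinish \<gamma>;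
      pathstart \<rho>' = pathfinish \<gamma>; pathfinish \<rho> = pathfinish \<rho>'; path_image \<rho> \<subseteq> ball x r;
      path_image \<rho>' \<subseteq> ball x r\<rbrakk> \<Longrightarrow> \<gamma> +++ \<rho> \<asymp> \<gamma> +++ \<rho>'"
    using locally_trivial[of x] unfolding based_def by blast
  have 1: "\<Union>{sheet \<gamma> r |\<gamma>. based \<gamma> \<and> pathfinish \<gamma> = x} = {C \<in> topspace cover. endpoint C \<in> ball x r}"
  proof (intro equalityI subsetI)
    fix C assume "C \<in> \<Union>{sheet \<gamma> r |\<gamma>. based \<gamma> \<and> pathfinish \<gamma> = x}"
    then obtain \<gamma> where "based \<gamma>" "pathfinish \<gamma> = x" "C \<in> sheet \<gamma> r" by blast
    then show "C \<in> {C \<in> topspace cover. endpoint C \<in> ball x r}"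
      using endpoint_sheet[of \<gamma> r] sheet_subset[of \<gamma> r] unfolding topspace_cover by blast
  next
    fix C assume "C \<in> {C \<in> topspace cover. endpoint C \<in> ball x r}"
    then obtain \<sigma> where \<sigma>: "based \<sigma>" "C = cls \<sigma>" "dist x (pathfinish \<sigma>) < r"
      using endpoint_cls unfolding topspace_cover by auto
    then obtain \<rho> where \<rho>: "path \<rho>" "pathstart \<rho> = x" "pathfinish \<rho> = pathfinish \<sigma>" "path_image \<rho> \<subseteq> ball x r"
      using length_space_geodesic[OF length_space, of x "pathfinish \<sigma>"] by metis
    let ?\<gamma> = "\<sigma> +++ reversepath \<rho>"
    have \<gamma>: "based ?\<gamma>" "pathfinish ?\<gamma> = x"
      using \<sigma> \<rho> by (auto intro: based_join)
    have "?\<gamma> +++ reversepath (reversepath \<rho>) \<asymp> \<sigma>"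
      using \<sigma> \<rho> by (intro cancel) (auto simp: based_def)
    then have "cls (?\<gamma> +++ \<rho>) = C"
      using \<sigma> by (simp add: cls_eq_iff)
    then have "C \<in> sheet ?\<gamma> r"
      unfolding sheet_def using \<rho> \<gamma> by (intro CollectI exI[of _ \<rho>]) auto
    with \<gamma> show "C \<in> \<Union>{sheet \<gamma> r |\<gamma>. based \<gamma> \<and> pathfinish \<gamma> = x}" by blast
  qed
  have eq: "sheet \<gamma> r = sheet \<gamma>' r"
    if \<gamma>: "based \<gamma>" "pathfinish \<gamma> = x" and \<gamma>': "based \<gamma>'" "pathfinish \<gamma>' = x"
      and C: "C \<in> sheet \<gamma> r" "C \<in> sheet \<gamma>' r" for \<gamma> \<gamma>' C
  proof -
    obtain \<rho> where \<rho>: "path \<rho>" "pathstart \<rho> = x" "path_image \<rho> \<subseteq> ball x r" "C = cls (\<gamma> +++ \<rho>)"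
      using C(1) \<gamma> unfolding sheet_def by blast
    obtain \<rho>' where \<rho>': "path \<rho>'" "pathstart \<rho>' = x" "path_image \<rho>' \<subseteq> ball x r" "C = cls (\<gamma>' +++ \<rho>')"
      using C(2) \<gamma>' unfolding sheet_def by blast
    have rel: "\<gamma> +++ \<rho> \<asymp> \<gamma>' +++ \<rho>'"
      using \<rho>(4) \<rho>'(1,2,4) \<gamma>' based_join by (intro rel_of_cls_eq) auto
    then have fin: "pathfinish \<rho> = pathfinish \<rho>'"
      using relD[OF rel] by simp
    have "\<gamma> +++ \<rho> \<asymp> \<gamma>' +++ \<rho>"
      by (rule trans[OF rel]) (use \<gamma>' \<rho> \<rho>' fin in \<open>auto intro: loc\<close>)
    then have "(\<gamma> +++ \<rho>) +++ reversepath \<rho> \<asymp> (\<gamma>' +++ \<rho>) +++ reversepath \<rho>"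
      by (rule cong) (use \<rho> in auto)
    moreover have "(\<gamma> +++ \<rho>) +++ reversepath \<rho> \<asymp> \<gamma>" "(\<gamma>' +++ \<rho>) +++ reversepath \<rho> \<asymp> \<gamma>'"
      using \<gamma> \<gamma>' \<rho> by (auto simp: based_def intro!: cancel)
    ultimately have "\<gamma> \<asymp> \<gamma>'"
      using trans sym by blast
    then have "cls (\<gamma> +++ \<rho>) = cls (\<gamma>' +++ \<rho>)" if "path \<rho>" "pathstart \<rho> = x" for \<rho>
      using cong that \<gamma> \<gamma>' by (subst cls_eq_iff) (auto intro: based_join)
    then show ?thesis
      unfolding sheet_def \<gamma>(2) \<gamma>'(2) by blast
  qed
  have 2: "pairwise disjnt {sheet \<gamma> r |\<gamma>. based \<gamma> \<and> pathfinish \<gamma> = x}"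
    unfolding pairwise_def disjnt_def using eq by blast
  have 3: "inj_on endpoint (sheet \<gamma> r)" if \<gamma>: "based \<gamma>" "pathfinish \<gamma> = x" for \<gamma>
  proof (rule inj_onI)
    fix C C' assume C: "C \<in> sheet \<gamma> r" "C' \<in> sheet \<gamma> r" "endpoint C = endpoint C'"
    obtain \<rho> where \<rho>: "path \<rho>" "pathstart \<rho> = x" "path_image \<rho> \<subseteq> ball x r" "C = cls (\<gamma> +++ \<rho>)"
      using C(1) \<gamma> unfolding sheet_def by blast
    obtain \<rho>' where \<rho>': "path \<rho>'" "pathstart \<rho>' = x" "path_image \<rho>' \<subseteq> ball x r" "C' = cls (\<gamma> +++ \<rho>')"
      using C(2) \<gamma> unfolding sheet_def by blast
    have "pathfinish \<rho> = pathfinish \<rho>'"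
      using C(3) \<gamma> \<rho> \<rho>' endpoint_cls[of "\<gamma> +++ \<rho>"] endpoint_cls[of "\<gamma> +++ \<rho>'"] based_join by simp
    then have "\<gamma> +++ \<rho> \<asymp> \<gamma> +++ \<rho>'"
      using \<gamma> \<rho> \<rho>' by (intro loc) auto
    then show "C = C'"
      using \<gamma> \<rho> \<rho>' by (simp add: cls_eq_iff based_join)
  qed
  show thesis
    using that[OF r 1 2 3] .
qed

lemma pathin_cover:
  assumes \<gamma>: "based \<gamma>" and \<rho>: "path \<rho>" "pathstart \<rho> = pathfinish \<gamma>"
  shows "pathin cover (\<lambda>t. cls (\<gamma> +++ (\<rho> \<circ> linepath 0 t)))"
  unfolding pathin_def continuous_map
proof (intro conjI allI impI)
  let ?l = "\<lambda>t. \<gamma> +++ (\<rho> \<circ> linepath 0 t)"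
  have seg: "path (\<rho> \<circ> linepath 0 t)" "pathstart (\<rho> \<circ> linepath 0 t) = pathfinish \<gamma>"
    if "t \<in> {0..1}" for t
    using path_segment[OF \<rho>(1) _ that, of 0] \<rho>(2) by (auto simp: pathstart_def)
  have l: "based (?l t)" if "t \<in> {0..1}" for t
    using based_join[OF \<gamma> seg[OF that]] .
  show "(\<lambda>t. cls (?l t)) ` topspace (top_of_set {0..1}) \<subseteq> topspace cover"
    using l by (auto simp: topspace_cover)
  fix V assume V: "openin cover V"
  show "openin (top_of_set {0..1}) {t \<in> topspace (top_of_set {0..1}). cls (?l t) \<in> V}"
    unfolding topspace_euclidean_subtopology openin_contains_ball
  proof (intro conjI ballI)
    fix t assume "t \<in> {t \<in> {0..1}. cls (?l t) \<in> V}"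
    then have t: "t \<in> {0..1}" "cls (?l t) \<in> V" by auto
    obtain r where r: "r > 0" "sheet (?l t) r \<subseteq> V"
      using V t l unfolding openin_cover by blast
    obtain d where d: "d > 0" "\<And>s. s \<in> {0..1} \<Longrightarrow> dist s t < d \<Longrightarrow> dist (\<rho> s) (\<rho> t) < r"
      using \<rho>(1) t(1) r(1) unfolding path_def continuous_on_iff by blast
    have "cls (?l s) \<in> V" if s: "s \<in> ball t d \<inter> {0..1}" for s
    proof -
      note ts = path_segment[OF \<rho>(1) t(1), of s]
      have fin: "pathfinish (?l t) = \<rho> t"
        using path_segment(4)[OF \<rho>(1) _ t(1), of 0] by simp
      have "dist (\<rho> u) (\<rho> t) < r" if "u \<in> closed_segment t s" for u
      proof (rule d(2))
        show "u \<in> {0..1}"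
          using that t(1) s by (auto simp: closed_segment_eq_real_ivl split: if_splits)
        show "dist u t < d"
          using that s by (auto simp: closed_segment_eq_real_ivl dist_real_def split: if_splits)
      qed
      then have im: "path_image (\<rho> \<circ> linepath t s) \<subseteq> ball (\<rho> t) r"
        using ts(2) s by (auto simp: dist_commute)
      have "?l t +++ (\<rho> \<circ> linepath t s) \<asymp> ?l s"
        using \<gamma> \<rho> t(1) s by (intro segments) (auto simp: based_def)
      then have "cls (?l t +++ (\<rho> \<circ> linepath t s)) = cls (?l s)"
        using l[of s] s by (simp add: cls_eq_iff)
      moreover have "cls (?l t +++ (\<rho> \<circ> linepath t s)) \<in> sheet (?l t) r"
        unfolding sheet_def fin using im ts s by blast
      ultimately show ?thesis
        using r(2) by auto
    qed
    then show "\<exists>d>0. ball t d \<inter> {0..1} \<subseteq> {t \<in> {0..1}. cls (?l t) \<in> V}"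
      using d(1) by blast
  qed auto
qed

theorem covering_map_cover: "covering_map cover endpoint euclidean"
  unfolding covering_map_def
proof (intro conjI ballI)
  show "endpoint ` topspace cover = topspace euclidean"
  proof -
    have "x \<in> endpoint ` topspace cover" for x
    proof -
      obtain \<gamma> where \<gamma>: "path \<gamma>" "pathstart \<gamma> = b" "pathfinish \<gamma> = x"
        using length_space_geodesic[OF length_space, of b x] by metis
      then have "based \<gamma>" by (simp add: based_def)
      then show ?thesis
        using \<gamma>(3) by (auto simp: topspace_cover endpoint_cls intro!: image_eqI[of _ _ "cls \<gamma>"])
    qed
    then show ?thesis by auto
  qed
  fix x :: 'a
  obtain r where r: "r > 0"
    "\<Union>{sheet \<gamma> r |\<gamma>. based \<gamma> \<and> pathfinish \<gamma> = x} = {C \<in> topspace cover. endpoint C \<in> ball x r}"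
    "pairwise disjnt {sheet \<gamma> r |\<gamma>. based \<gamma> \<and> pathfinish \<gamma> = x}"
    "\<And>\<gamma>. based \<gamma> \<Longrightarrow> pathfinish \<gamma> = x \<Longrightarrow> inj_on endpoint (sheet \<gamma> r)"
    by (rule evenly_covered[of x]) (rule that)
  have hom: "homeomorphic_map (subtopology cover (sheet \<gamma> r)) (top_of_set (ball x r)) endpoint"
    if \<gamma>: "based \<gamma>" "pathfinish \<gamma> = x" for \<gamma>
  proof (rule bijective_open_imp_homeomorphic_map)
    have top: "topspace (subtopology cover (sheet \<gamma> r)) = sheet \<gamma> r"
      using openin_subset[OF openin_sheet[OF \<gamma>(1)]] by auto
    show im: "endpoint ` topspace (subtopology cover (sheet \<gamma> r)) = topspace (top_of_set (ball x r))"
      unfolding top using endpoint_sheet[OF \<gamma>(1)] \<gamma>(2) by simp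
    show "inj_on endpoint (topspace (subtopology cover (sheet \<gamma> r)))"
      unfolding top using r(4) \<gamma> by blast
    show "continuous_map (subtopology cover (sheet \<gamma> r)) (top_of_set (ball x r)) endpoint"
      using im continuous_map_from_subtopology[OF continuous_map_endpoint]
      by (auto simp: continuous_map_in_subtopology)
    show "open_map (subtopology cover (sheet \<gamma> r)) (top_of_set (ball x r)) endpoint"
      using im open_map_from_subtopology[OF open_map_endpoint openin_sheet[OF \<gamma>(1)]]
      by (intro open_map_into_subtopology) auto
  qed
  show "\<exists>U. x \<in> U \<and> openin euclidean U \<and>
      (\<exists>\<V>. \<Union>\<V> = {C \<in> topspace cover. endpoint C \<in> U} \<and> (\<forall>v\<in>\<V>. openin cover v) \<and> pairwise disjnt \<V> \<and>
        (\<forall>v\<in>\<V>. homeomorphic_map (subtopology cover v) (top_of_set U) endpoint))"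
    by (intro exI[of _ "ball x r"] conjI exI[of _ "{sheet \<gamma> r |\<gamma>. based \<gamma> \<and> pathfinish \<gamma> = x}"])
       (use r hom openin_sheet in auto)
qed (rule continuous_map_endpoint)

sublocale covering cover endpoint
  by unfold_locales (rule covering_map_cover)

text \<open>The lift of \<open>\<rho>\<close> starting at the class of \<open>\<gamma>\<close> extends \<open>\<gamma>\<close> by longer and longer initial segments of \<open>\<rho>\<close>.\<close>

lemma transport_cls:
  assumes \<gamma>: "based \<gamma>" and \<rho>: "path \<rho>" "pathstart \<rho> = pathfinish \<gamma>"
  shows "transport \<rho> (cls \<gamma>) = cls (\<gamma> +++ \<rho>)"
proof -
  have "transport \<rho> (cls (\<gamma> +++ (\<rho> \<circ> linepath 0 0))) = cls (\<gamma> +++ (\<rho> \<circ> linepath 0 1))"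
  proof (rule transport_equality[OF pathin_cover[OF assms]])
    fix t :: real assume t: "t \<in> {0..1}"
    have "based (\<gamma> +++ (\<rho> \<circ> linepath 0 t))"
      using path_segment[OF \<rho>(1) _ t, of 0] \<rho>(2) by (intro based_join[OF \<gamma>]) (auto simp: pathstart_def)
    then show "endpoint (cls (\<gamma> +++ (\<rho> \<circ> linepath 0 t))) = \<rho> t"
      using path_segment(4)[OF \<rho>(1) _ t, of 0] by (simp add: endpoint_cls)
  qed
  moreover have "\<rho> \<circ> linepath 0 0 = (\<lambda>_. pathfinish \<gamma>)" "\<rho> \<circ> linepath 0 1 = \<rho>"
    using \<rho>(2) by (auto simp: linepath_def pathstart_def)
  moreover have "cls (\<gamma> +++ (\<lambda>_. pathfinish \<gamma>)) = cls \<gamma>"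
    using \<gamma> unit_right by (simp add: cls_eq_iff based_def)
  ultimately show ?thesis by simp
qed

lemma connected_space_cover: "connected_space cover"
proof -
  have based_const: "based (\<lambda>_. b)"
    by (simp add: based_def path_def pathstart_def)
  let ?b = "cls (\<lambda>_. b)"
  have "connected_component_of cover ?b C" if C: "C \<in> topspace cover" for C
  proof -
    obtain \<gamma> where \<gamma>: "based \<gamma>" "C = cls \<gamma>"
      using C unfolding topspace_cover by blast
    have b: "path \<gamma>" "?b \<in> topspace cover" "endpoint ?b = pathstart \<gamma>"
      using \<gamma> based_const endpoint_cls[OF based_const]
      by (auto simp: topspace_cover based_def pathfinish_def)
    have "transport \<gamma> ?b = C"
      using transport_cls[OF based_const, of \<gamma>] \<gamma> unit_left
      by (simp add: based_def pathfinish_def cls_eq_iff)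
    then have "path_component_of cover ?b C"
      unfolding path_component_of_def transport_def using pathin_lift[OF b] lift_0[OF b] by blast
    then show ?thesis
      by (rule path_imp_connected_component_of)
  qed
  then show ?thesis
    unfolding connected_space_iff_connected_component
    using connected_component_of_sym connected_component_of_trans by metis
qed

end

section \<open>Universal covers of length spaces\<close>

lemma (in covering) transport_morphism:
  fixes E' :: "'c topology"
  assumes E': "covering E' \<pi>'" and f: "continuous_map E E' f" "\<And>e. e \<in> topspace E \<Longrightarrow> \<pi>' (f e) = \<pi> e"
    and \<gamma>: "path \<gamma>" "e \<in> topspace E" "\<pi> e = pathstart \<gamma>"
  shows "covering.transport E' \<pi>' \<gamma> (f e) = f (transport \<gamma> e)"
proof -
  interpret E': covering E' \<pi>' by (rule E')
  have "pathin E' (f \<circ> lift \<gamma> e)"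
    using pathin_lift[OF \<gamma>] f(1) unfolding pathin_def by (rule continuous_map_compose)
  then have "E'.transport \<gamma> ((f \<circ> lift \<gamma> e) 0) = (f \<circ> lift \<gamma> e) 1"
  proof (rule E'.transport_equality)
    fix t :: real assume "t \<in> {0..1}"
    then show "\<pi>' ((f \<circ> lift \<gamma> e) t) = \<gamma> t"
      using f(2)[OF lift_topspace[OF \<gamma>]] projection_lift[OF \<gamma>] by simp
  qed
  then show ?thesis
    using lift_0[OF \<gamma>] by (simp add: transport_def)
qed

lemma (in covering) transport_join_reversepath_iff:
  assumes c: "path c" "pathstart c = \<pi> e" and c': "path c'" "pathstart c' = \<pi> e" "pathfinish c' = pathfinish c"
    and e: "e \<in> topspace E"
  shows "transport (c +++ reversepath c') e = e \<longleftrightarrow> transport c e = transport c' e"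
proof -
  let ?z = "transport c e"
  have z: "?z \<in> topspace E" "\<pi> ?z = pathstart (reversepath c')"
    using transport_topspace[OF c(1) e] projection_transport[OF c(1) e] c c' by simp_all
  have join: "transport (c +++ reversepath c') e = transport (reversepath c') ?z"
    using c c' e by (intro transport_join) auto
  have reverse: "transport (reversepath c') (transport c' e) = e"
    using c' e by (intro transport_reversepath) auto
  have forth: "transport c' (transport (reversepath c') ?z) = ?z"
    using transport_reversepath[of "reversepath c'" ?z] c' z by simp
  show ?thesis
    using join reverse forth by metis
qed

text \<open>In place of simple connectedness, universality is exploited through the fact that every
congruence of paths gives a connected cover, to which \<open>E\<close> then maps.\<close>

locale universal_length_cover = covering E \<pi>
  for E :: "'b topology" and \<pi> :: "'b \<Rightarrow> 'a::metric_space" +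
  assumes length_space: "length_space TYPE('a)"
    and universal: "universal_cover E \<pi>"
begin

lemma connected_space_cover: "connected_space E"
  using universal by (simp add: universal_cover_def cover_of_space_def)

text \<open>A map of covers sends lifts to lifts. Hence \<open>\<rho>\<close>, having a closed lift to \<open>E\<close>, has one to the cover of
the congruence, starting at the image \<open>cls \<gamma>\<close> of \<open>e\<close>.\<close>

lemma closed_lift_congruent:
  assumes pc: "path_congruence b rel"
    and \<rho>: "path \<rho>" "pathstart \<rho> = \<pi> e" and e: "e \<in> topspace E" and closed: "transport \<rho> e = e"
  obtains \<gamma> where "path \<gamma>" "pathstart \<gamma> = b" "pathfinish \<gamma> = \<pi> e" "rel (\<gamma> +++ \<rho>) \<gamma>"
proof -
  interpret C: path_congruence b rel by (rule pc)
  have "cover_of_space C.cover C.endpoint"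
    by (simp add: cover_of_space_def C.connected_space_cover C.covering_map_cover)
  then obtain f where f: "covering_map E f C.cover" "\<forall>e\<in>topspace E. C.endpoint (f e) = \<pi> e"
    using universal unfolding universal_cover_def by blast
  have cont: "continuous_map E C.cover f"
    using f(1) by (simp add: covering_map_def)
  then have "f e \<in> topspace C.cover"
    using e by (auto simp: continuous_map_def)
  then obtain \<gamma> where \<gamma>: "C.based \<gamma>" "f e = C.cls \<gamma>"
    by (auto simp: C.topspace_cover)
  have fin: "pathfinish \<gamma> = \<pi> e"
    using f(2) e \<gamma> C.endpoint_cls by metis
  have "C.cls (\<gamma> +++ \<rho>) = C.transport \<rho> (f e)"
    using C.transport_cls[OF \<gamma>(1) \<rho>(1)] \<rho>(2) fin \<gamma>(2) by simp
  also have "\<dots> = f (transport \<rho> e)"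
    by (rule transport_morphism) (use C.covering_axioms cont f(2) \<rho> e in auto)
  also have "\<dots> = C.cls \<gamma>"
    using closed \<gamma>(2) by simp
  finally have "rel (\<gamma> +++ \<rho>) \<gamma>"
    using C.cls_eq_iff[OF \<gamma>(1)] by simp
  with \<gamma>(1) fin that show thesis
    by (auto simp: C.based_def)
qed

text \<open>The covering group of this congruence is the core of that of \<open>E\<close>, the largest normal subgroup
contained in it. It is trivial on small balls because \<open>E\<close> evenly covers them.\<close>

lemma path_congruence_transport:
  "path_congruence b (\<lambda>\<gamma> \<gamma>'. path \<gamma> \<and> pathstart \<gamma> = b \<and> path \<gamma>' \<and> pathstart \<gamma>' = b \<and>
     pathfinish \<gamma> = pathfinish \<gamma>' \<and> (\<forall>e\<in>topspace E. \<pi> e = b \<longrightarrow> transport \<gamma> e = transport \<gamma>' e))"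
  (is "path_congruence b ?rel")
proof
  show "length_space TYPE('a)" by (rule length_space)
next
  fix \<gamma> \<gamma>' \<rho> assume *: "?rel \<gamma> \<gamma>'" "path \<rho>" "pathstart \<rho> = pathfinish \<gamma>"
  have "transport (\<gamma> +++ \<rho>) e = transport (\<gamma>' +++ \<rho>) e" if "e \<in> topspace E" "\<pi> e = b" for e
    using * that by (simp add: transport_join)
  with * show "?rel (\<gamma> +++ \<rho>) (\<gamma>' +++ \<rho>)" by auto
next
  fix \<gamma> \<rho> \<rho>' assume *: "path \<gamma>" "pathstart \<gamma> = b" "path \<rho>" "path \<rho>'" "pathstart \<rho> = pathfinish \<gamma>"
    "pathstart \<rho>' = pathfinish \<rho>"
  have "transport ((\<gamma> +++ \<rho>) +++ \<rho>') e = transport (\<gamma> +++ (\<rho> +++ \<rho>')) e"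
    if "e \<in> topspace E" "\<pi> e = b" for e
    using * that by (simp add: transport_join transport_topspace projection_transport)
  with * show "?rel ((\<gamma> +++ \<rho>) +++ \<rho>') (\<gamma> +++ (\<rho> +++ \<rho>'))" by auto
next
  fix \<gamma> \<rho> assume *: "path \<gamma>" "pathstart \<gamma> = b" "path \<rho>" "pathstart \<rho> = pathfinish \<gamma>"
  have "transport ((\<gamma> +++ \<rho>) +++ reversepath \<rho>) e = transport \<gamma> e" if "e \<in> topspace E" "\<pi> e = b" for e
    using * that
    by (simp add: transport_join transport_topspace projection_transport transport_reversepath)
  with * show "?rel ((\<gamma> +++ \<rho>) +++ reversepath \<rho>) \<gamma>" by auto
next
  fix \<gamma> \<rho> and s t :: real
  assume *: "path \<gamma>" "pathstart \<gamma> = b" "path \<rho>" "pathstart \<rho> = pathfinish \<gamma>" "s \<in> {0..1}" "t \<in> {0..1}"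
  have zero: "(0::real) \<in> {0..1}" by simp
  have \<rho>0: "\<rho> 0 = pathfinish \<gamma>"
    using *(4) by (simp add: pathstart_def)
  note segs = path_segment[OF *(3) zero *(5)] path_segment[OF *(3) *(5,6)] path_segment[OF *(3) zero *(6)]
  have "transport ((\<gamma> +++ (\<rho> \<circ> linepath 0 s)) +++ (\<rho> \<circ> linepath s t)) e = transport (\<gamma> +++ (\<rho> \<circ> linepath 0 t)) e"
    if e: "e \<in> topspace E" "\<pi> e = b" for e
  proof -
    let ?m = "transport \<gamma> e"
    have m: "path \<rho>" "?m \<in> topspace E" "\<pi> ?m = pathstart \<rho>"
      using * e by (simp_all add: transport_topspace projection_transport)
    have "transport (\<rho> \<circ> linepath 0 s) ?m = lift \<rho> ?m s" "transport (\<rho> \<circ> linepath 0 t) ?m = lift \<rho> ?m t"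
      "transport (\<rho> \<circ> linepath s t) (lift \<rho> ?m s) = lift \<rho> ?m t"
      using transport_segment[OF m zero *(5)] transport_segment[OF m zero *(6)]
        transport_segment[OF m *(5,6)] lift_0[OF m] by simp_all
    then show ?thesis
      using * e segs \<rho>0 by (simp add: transport_join)
  qed
  with * segs \<rho>0 show "?rel ((\<gamma> +++ (\<rho> \<circ> linepath 0 s)) +++ (\<rho> \<circ> linepath s t)) (\<gamma> +++ (\<rho> \<circ> linepath 0 t))"
    by simp
next
  fix \<gamma> assume *: "path \<gamma>" "pathstart \<gamma> = b"
  have const: "path (\<lambda>_. x)" "pathstart (\<lambda>_. x) = x" "pathfinish (\<lambda>_. x) = x" for x :: 'a
    by (simp_all add: path_def pathstart_def pathfinish_def)
  have "transport (\<gamma> +++ (\<lambda>_. pathfinish \<gamma>)) e = transport \<gamma> e" if "e \<in> topspace E" "\<pi> e = b" for e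
    using * that const by (simp add: transport_join transport_const transport_topspace projection_transport)
  with * const show "?rel (\<gamma> +++ (\<lambda>_. pathfinish \<gamma>)) \<gamma>" by simp
  have "transport ((\<lambda>_. b) +++ \<gamma>) e = transport \<gamma> e" if "e \<in> topspace E" "\<pi> e = b" for e
    using * that const by (simp add: transport_join transport_const)
  with * const show "?rel ((\<lambda>_. b) +++ \<gamma>) \<gamma>" by simp
next
  fix x :: 'a
  obtain r s where r: "r > 0" and s: "local_sections E \<pi> (ball x r) s"
    using covering_map_local_sections[OF covering_map] by blast
  have "?rel (\<gamma> +++ \<rho>) (\<gamma> +++ \<rho>')"
    if *: "path \<gamma>" "pathstart \<gamma> = b" "path \<rho>" "path \<rho>'" "pathstart \<rho> = pathfinish \<gamma>"
      "pathstart \<rho>' = pathfinish \<gamma>" "pathfinish \<rho> = pathfinish \<rho>'" "path_image \<rho> \<subseteq> ball x r"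
      "path_image \<rho>' \<subseteq> ball x r" for \<gamma> \<rho> \<rho>'
  proof -
    have "transport (\<gamma> +++ \<rho>) e = transport (\<gamma> +++ \<rho>') e" if e: "e \<in> topspace E" "\<pi> e = b" for e
    proof -
      have m: "transport \<gamma> e \<in> topspace E" "\<pi> (transport \<gamma> e) = pathfinish \<gamma>"
        using * e by (simp_all add: transport_topspace projection_transport)
      show ?thesis
        using * e m transport_local_section[OF s *(3,8) m(1)] transport_local_section[OF s *(4,9) m(1)]
        by (simp add: transport_join)
    qed
    with * show ?thesis by simp
  qed
  with r show "\<exists>r>0. \<forall>\<gamma> \<rho> \<rho>'. path \<gamma> \<and> pathstart \<gamma> = b \<and> path \<rho> \<and> path \<rho>' \<and>
      pathstart \<rho> = pathfinish \<gamma> \<and> pathstart \<rho>' = pathfinish \<gamma> \<and> pathfinish \<rho> = pathfinish \<rho>' \<and>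
      path_image \<rho> \<subseteq> ball x r \<and> path_image \<rho>' \<subseteq> ball x r \<longrightarrow> ?rel (\<gamma> +++ \<rho>) (\<gamma> +++ \<rho>')"
    by (intro exI[of _ r]) simp
qed auto

text \<open>By universality \<open>E\<close> covers the cover belonging to the core of its own covering group, so the
two groups agree, and \<open>E\<close> is a regular cover.\<close>

lemma closed_lift_regular:
  assumes \<rho>: "path \<rho>" "pathstart \<rho> = \<pi> e" and e: "e \<in> topspace E" and closed: "transport \<rho> e = e"
    and e': "e' \<in> topspace E" "\<pi> e' = \<pi> e"
  shows "transport \<rho> e' = e'"
proof -
  obtain \<gamma> where \<gamma>: "path \<gamma>" "pathstart \<gamma> = \<pi> e" "pathfinish \<gamma> = \<pi> e"
    and rel: "\<And>e'. e' \<in> topspace E \<Longrightarrow> \<pi> e' = \<pi> e \<Longrightarrow> transport (\<gamma> +++ \<rho>) e' = transport \<gamma> e'"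
    using closed_lift_congruent[OF path_congruence_transport[of "\<pi> e"] \<rho> e closed] by metis
  let ?d = "transport (reversepath \<gamma>) e'"
  have d: "?d \<in> topspace E" "\<pi> ?d = \<pi> e"
    using transport_topspace[of "reversepath \<gamma>" e'] projection_transport[of "reversepath \<gamma>" e'] \<gamma> e' by simp_all
  have d': "transport \<gamma> ?d = e'"
    using transport_reversepath[of "reversepath \<gamma>" e'] \<gamma> e' by simp
  have "transport (\<gamma> +++ \<rho>) ?d = transport \<rho> (transport \<gamma> ?d)"
    using \<gamma> \<rho> d by (intro transport_join) auto
  then show ?thesis
    using rel[OF d] d' by simp
qed

text \<open>The set of points that can be reached by lifts of rectifiable curves is open and closed, since
geodesics in evenly covered balls lift.\<close>

lemma rectifiable_transport:
  assumes e0: "e0 \<in> topspace E" and e: "e \<in> topspace E"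
  obtains c where "path c" "pathstart c = \<pi> e0" "transport c e0 = e" "curve_length c < \<infinity>"
proof -
  define A where "A = {e \<in> topspace E. \<exists>c. path c \<and> pathstart c = \<pi> e0 \<and> transport c e0 = e \<and> curve_length c < \<infinity>}"
  have step: "transport \<rho> e \<in> A"
    if e: "e \<in> A" and \<rho>: "path \<rho>" "pathstart \<rho> = \<pi> e" "curve_length \<rho> < \<infinity>" for e \<rho>
  proof -
    obtain c where c: "path c" "pathstart c = \<pi> e0" "transport c e0 = e" "curve_length c < \<infinity>"
      using e unfolding A_def by blast
    have fin: "pathstart \<rho> = pathfinish c"
      using projection_transport[OF c(1) e0] c \<rho> by simp
    have "transport (c +++ \<rho>) e0 = transport \<rho> e"
      using c fin \<rho>(1) e0 by (simp add: transport_join)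
    moreover have "curve_length (c +++ \<rho>) < \<infinity>"
      using curve_length_join_le[of c \<rho>] c \<rho> fin
      by (metis infinity_ennreal_def ennreal_add_eq_top less_top order_le_less_trans)
    moreover have "path (c +++ \<rho>)" "pathstart (c +++ \<rho>) = \<pi> e0"
      using c \<rho> fin by simp_all
    moreover have "transport \<rho> e \<in> topspace E"
      using e \<rho> unfolding A_def by (simp add: transport_topspace)
    ultimately show ?thesis
      unfolding A_def by blast
  qed
  have nbhd: "\<exists>W. openin E W \<and> e \<in> W \<and> (\<forall>e'\<in>W. e' \<in> A \<longleftrightarrow> e \<in> A)" if e: "e \<in> topspace E" for e
  proof -
    obtain r s where r: "r > 0" and s: "local_sections E \<pi> (ball (\<pi> e) r) s"
      using covering_map_local_sections[OF covering_map] by blast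
    let ?B = "ball (\<pi> e) r"
    have eB: "\<pi> e \<in> ?B" using r by simp
    note se = local_sectionsD[OF s e eB]
    have "s e y \<in> A \<longleftrightarrow> e \<in> A" if y: "y \<in> ?B" for y
    proof -
      obtain \<rho> where \<rho>: "path \<rho>" "pathstart \<rho> = \<pi> e" "pathfinish \<rho> = y"
          "curve_length \<rho> = ennreal (dist (\<pi> e) y)" "path_image \<rho> \<subseteq> ?B"
        using length_space_geodesic[OF length_space, of "\<pi> e" y] y by (metis mem_ball)
      have t: "transport \<rho> e = s e y"
        using transport_local_section[OF s \<rho>(1,5) e] \<rho> by simp
      have t': "transport (reversepath \<rho>) (s e y) = e"
        using transport_reversepath[OF \<rho>(1) e] t \<rho>(2) by simp
      have l: "curve_length \<rho> < \<infinity>" "curve_length (reversepath \<rho>) < \<infinity>"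
        using \<rho>(4) curve_length_reversepath_le[of \<rho>] by (simp_all add: order_le_less_trans)
      show ?thesis
      proof
        assume "s e y \<in> A"
        from step[OF this, of "reversepath \<rho>"] show "e \<in> A"
          using \<rho> l t' se(4)[OF y] by simp
      next
        assume "e \<in> A"
        from step[OF this, of \<rho>] show "s e y \<in> A"
          using \<rho> l t by simp
      qed
    qed
    then show ?thesis
      using se(2,3) eB by (intro exI[of _ "s e ` ?B"]) (metis imageE imageI)
  qed
  have sub: "A \<subseteq> topspace E"
    unfolding A_def by blast
  have "openin E A"
  proof (subst openin_subopen, intro ballI)
    fix e assume e: "e \<in> A"
    then obtain W where "openin E W" "e \<in> W" "\<forall>e'\<in>W. e' \<in> A \<longleftrightarrow> e \<in> A"
      using nbhd sub by blast
    with e show "\<exists>W. openin E W \<and> e \<in> W \<and> W \<subseteq> A" by blast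
  qed
  moreover have "openin E (topspace E - A)"
  proof (subst openin_subopen, intro ballI)
    fix e assume e: "e \<in> topspace E - A"
    then obtain W where W: "openin E W" "e \<in> W" "\<forall>e'\<in>W. e' \<in> A \<longleftrightarrow> e \<in> A"
      using nbhd by blast
    with e openin_subset[OF W(1)] show "\<exists>W. openin E W \<and> e \<in> W \<and> W \<subseteq> topspace E - A" by blast
  qed
  moreover have "e0 \<in> A"
  proof -
    have "curve_length (\<lambda>_. \<pi> e0) < \<infinity>"
    proof -
      have "polygon_length (\<lambda>_. \<pi> e0) ts \<le> 0" for ts
        by (induction "\<lambda>_::real. \<pi> e0" ts rule: polygon_length.induct) auto
      then have "curve_length (\<lambda>_. \<pi> e0) \<le> 0" by (intro curve_length_le)
      then show ?thesis by (simp add: order_le_less_trans)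
    qed
    moreover have "path (\<lambda>_. \<pi> e0)" "pathstart (\<lambda>_. \<pi> e0) = \<pi> e0"
      by (simp_all add: path_def pathstart_def)
    ultimately show ?thesis
      unfolding A_def using e0 transport_const[OF e0 HOL.refl] by blast
  qed
  ultimately have "A = topspace E"
    using connected_space_cover sub unfolding connected_space_clopen_in closedin_def by blast
  then show thesis
    using e that unfolding A_def by blast
qed

text \<open>The lift of a map through a cover: transport \<open>e1\<close> along a path that transports \<open>e0\<close> to \<open>e\<close>. Regularity
makes the result independent of the path.\<close>

lemma deck_map_exists:
  assumes e0: "e0 \<in> topspace E" and e1: "e1 \<in> topspace E" "\<pi> e1 = \<pi> e0"
  obtains h where "continuous_map E E h" "\<And>e. e \<in> topspace E \<Longrightarrow> \<pi> (h e) = \<pi> e" "h e0 = e1"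
proof -
  define h where "h e = (SOME e'. \<exists>c. path c \<and> pathstart c = \<pi> e0 \<and> transport c e0 = e \<and> transport c e1 = e')" for e
  have h: "h (transport c e0) = transport c e1" if c: "path c" "pathstart c = \<pi> e0" for c
  proof -
    have "\<exists>c'. path c' \<and> pathstart c' = \<pi> e0 \<and> transport c' e0 = transport c e0 \<and>
        transport c' e1 = h (transport c e0)"
      unfolding h_def
      by (rule someI[of "\<lambda>e'. \<exists>c'. path c' \<and> pathstart c' = \<pi> e0 \<and> transport c' e0 = transport c e0 \<and>
        transport c' e1 = e'" "transport c e1"]) (use c in blast)
    then obtain c' where c': "path c'" "pathstart c' = \<pi> e0" "transport c' e0 = transport c e0"
        "transport c' e1 = h (transport c e0)"
      by blast
    have fin: "pathfinish c' = pathfinish c"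
      using projection_transport[of c e0] projection_transport[of c' e0] c c' e0 by simp
    have "transport (c +++ reversepath c') e0 = e0"
      using transport_join_reversepath_iff[OF c c'(1,2) fin e0] c'(3) by simp
    moreover have "path (c +++ reversepath c')" "pathstart (c +++ reversepath c') = \<pi> e0"
      using c c'(1,2) fin by simp_all
    ultimately have "transport (c +++ reversepath c') e1 = e1"
      using closed_lift_regular e0 e1 by blast
    moreover have "pathstart c = \<pi> e1" "pathstart c' = \<pi> e1"
      using c(2) c'(2) e1(2) by simp_all
    ultimately have "transport c e1 = transport c' e1"
      using transport_join_reversepath_iff[of c e1 c'] c(1) c'(1) fin e1(1) by blast
    then show ?thesis
      using c'(4) by simp
  qed
  have via: "\<exists>c. path c \<and> pathstart c = \<pi> e0 \<and> transport c e0 = e" if "e \<in> topspace E" for e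
    using rectifiable_transport[OF e0 that] by blast
  have h_top: "h e \<in> topspace E" and h_proj: "\<pi> (h e) = \<pi> e" if e: "e \<in> topspace E" for e
  proof -
    obtain c where c: "path c" "pathstart c = \<pi> e0" "transport c e0 = e"
      using via[OF e] by blast
    then show "h e \<in> topspace E" "\<pi> (h e) = \<pi> e"
      using h[OF c(1,2)] transport_topspace[of c e1] projection_transport[of c e0] projection_transport[of c e1]
        e0 e1 by simp_all
  qed
  have "continuous_map E E h"
    unfolding continuous_map
  proof (intro conjI allI impI)
    show "h ` topspace E \<subseteq> topspace E"
      using h_top by blast
    fix U assume U: "openin E U"
    show "openin E {e \<in> topspace E. h e \<in> U}"
    proof (subst openin_subopen, intro ballI)
      fix e assume "e \<in> {e \<in> topspace E. h e \<in> U}"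
      then have e: "e \<in> topspace E" "h e \<in> U" by auto
      obtain c where c: "path c" "pathstart c = \<pi> e0" "transport c e0 = e"
        using via[OF e(1)] by blast
      have c1: "transport c e1 = h e"
        using h[OF c(1,2)] c(3) by simp
      obtain r s where r: "r > 0" and s: "local_sections E \<pi> (ball (\<pi> e) r) s"
        using covering_map_local_sections[OF covering_map] by blast
      let ?B = "ball (\<pi> e) r"
      have eB: "\<pi> e \<in> ?B" "\<pi> (h e) \<in> ?B" using r h_proj[OF e(1)] by simp_all
      note se = local_sectionsD[OF s e(1) eB(1)]
      note sh = local_sectionsD[OF s h_top[OF e(1)] eB(2)]
      \<comment> \<open>Over \<open>?B\<close>, \<open>h\<close> is the change of sheets from that of \<open>e\<close> to that of \<open>h e\<close>.\<close>
      have h_se: "h (s e y) = s (h e) y" if y: "y \<in> ?B" for y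
      proof -
        obtain \<rho> where \<rho>: "path \<rho>" "pathstart \<rho> = \<pi> e" "pathfinish \<rho> = y" "path_image \<rho> \<subseteq> ?B"
          using length_space_geodesic[OF length_space, of "\<pi> e" y] y by (metis mem_ball)
        have fin: "pathstart \<rho> = pathfinish c"
          using projection_transport[of c e0] c \<rho> e0 by simp
        have "transport (c +++ \<rho>) e0 = s e y"
          using transport_local_section[OF s \<rho>(1,4) e(1)] c \<rho> fin e0 by (simp add: transport_join)
        moreover have "transport (c +++ \<rho>) e1 = s (h e) y"
          using transport_local_section[OF s \<rho>(1,4) h_top[OF e(1)]] c \<rho> fin e1 c1 h_proj[OF e(1)]
          by (simp add: transport_join)
        moreover have "h (transport (c +++ \<rho>) e0) = transport (c +++ \<rho>) e1"
          using c \<rho> fin by (intro h) auto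
        ultimately show ?thesis by simp
      qed
      let ?B' = "{y \<in> ?B. s (h e) y \<in> U}"
      have "openin (top_of_set ?B) ?B'"
        using openin_continuous_map_preimage[OF sh(1) U] by simp
      then have "open ?B'"
        by (rule openin_open_trans) simp
      then have "openin E {e' \<in> topspace E. \<pi> e' \<in> ?B'}"
        using openin_continuous_map_preimage[OF continuous_map_projection, of ?B'] by simp
      then have "openin E (s e ` ?B \<inter> {e' \<in> topspace E. \<pi> e' \<in> ?B'})"
        using se(3) by blast
      moreover have "e \<in> s e ` ?B \<inter> {e' \<in> topspace E. \<pi> e' \<in> ?B'}"
        using imageI[OF eB(1), of "s e"] se(2) sh(2) e eB h_proj[OF e(1)] by simp
      moreover have "s e ` ?B \<inter> {e' \<in> topspace E. \<pi> e' \<in> ?B'} \<subseteq> {e \<in> topspace E. h e \<in> U}"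
      proof
        fix e' assume e': "e' \<in> s e ` ?B \<inter> {e' \<in> topspace E. \<pi> e' \<in> ?B'}"
        then obtain y where y: "y \<in> ?B" "e' = s e y" by blast
        have "\<pi> e' = y" using se(4)[OF y(1)] y(2) by simp
        then have "s (h e) y \<in> U" using e' by blast
        then have "h e' \<in> U" using h_se[OF y(1)] y(2) by simp
        then show "e' \<in> {e \<in> topspace E. h e \<in> U}" using e' by blast
      qed
      ultimately show "\<exists>W. openin E W \<and> e \<in> W \<and> W \<subseteq> {e \<in> topspace E. h e \<in> U}" by blast
    qed
  qed
  moreover have "h e0 = e1"
  proof -
    have "path (\<lambda>_. \<pi> e0)" "pathstart (\<lambda>_. \<pi> e0) = \<pi> e0"
      by (simp_all add: path_def pathstart_def)
    from h[OF this] show ?thesis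
      using transport_const[OF e0 HOL.refl] transport_const[OF e1] by simp
  qed
  ultimately show thesis
    using that h_proj by blast
qed

lemma deck_transformation_exists:
  assumes e0: "e0 \<in> topspace E" and e1: "e1 \<in> topspace E" "\<pi> e1 = \<pi> e0"
  obtains h where "deck_transformation E \<pi> h" "h e0 = e1"
proof -
  have inverse: "k (h e) = e"
    if h: "continuous_map E E h" "\<And>e. e \<in> topspace E \<Longrightarrow> \<pi> (h e) = \<pi> e" "h a = c"
      and k: "continuous_map E E k" "\<And>e. e \<in> topspace E \<Longrightarrow> \<pi> (k e) = \<pi> e" "k c = a"
      and a: "a \<in> topspace E" and e: "e \<in> topspace E" for h k a c e
  proof -
    have cont: "continuous_map E E (k \<circ> h)" "continuous_map E E (\<lambda>e. e)"
      using continuous_map_compose[OF h(1) k(1)] by simp_all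
    have proj: "\<pi> ((k \<circ> h) e) = \<pi> e" if "e \<in> topspace E" for e
    proof -
      have "h e \<in> topspace E"
        using h(1) that by (auto simp: continuous_map_def)
      then show ?thesis using h(2) k(2) that by simp
    qed
    have "(k \<circ> h) a = a"
      using h(3) k(3) by simp
    from lifts_equal[OF covering_map connected_space_cover cont proj a this e]
    show ?thesis by simp
  qed
  obtain h where h: "continuous_map E E h" "\<And>e. e \<in> topspace E \<Longrightarrow> \<pi> (h e) = \<pi> e" "h e0 = e1"
    using deck_map_exists[OF e0 e1] by blast
  obtain k where k: "continuous_map E E k" "\<And>e. e \<in> topspace E \<Longrightarrow> \<pi> (k e) = \<pi> e" "k e1 = e0"
    using deck_map_exists[OF e1(1) e0] e1(2) by metis
  have "homeomorphic_maps E E h k"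
    unfolding homeomorphic_maps_def
    using h(1) k(1) inverse[OF h k e0] inverse[OF k h e1(1)] by blast
  then have "deck_transformation E \<pi> h"
    unfolding deck_transformation_def using h(2) homeomorphic_map_maps by blast
  with h(3) that show thesis by blast
qed

lemma deck_action_lift:
  assumes e0: "e0 \<in> topspace E" and g: "g \<in> carrier (fundamental_group (\<pi> e0))"
  obtains c where "deck_transformation E \<pi> (deck_action E \<pi> e0 g)"
    "path c" "pathstart c = \<pi> e0" "pathfinish c = \<pi> e0" "path_class c = g"
    "transport c e0 = deck_action E \<pi> e0 g e0"
proof -
  let ?P = "\<lambda>h. deck_transformation E \<pi> h \<and>
        (\<exists>\<gamma>. pathin E \<gamma> \<and> \<gamma> 0 = e0 \<and> path_class (\<pi> \<circ> \<gamma>) = g \<and> h e0 = \<gamma> 1)"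
  obtain c where c: "path c" "pathstart c = \<pi> e0" "pathfinish c = \<pi> e0" "path_class c = g"
    using g by (auto simp: fundamental_group_def)
  note c' = c(1) e0 c(2)[symmetric]
  obtain h where "deck_transformation E \<pi> h" "h e0 = transport c e0"
    using deck_transformation_exists[OF e0 transport_topspace[OF c']] projection_transport[OF c'] c(3) by metis
  moreover have "path_class (\<pi> \<circ> lift c e0) = g"
    using path_class_cong[OF c(1), of "\<pi> \<circ> lift c e0"] projection_lift[OF c'] c(4) by simp
  ultimately have "?P h"
    using pathin_lift[OF c'] lift_0[OF c'] unfolding transport_def by blast
  then have P: "?P (deck_action E \<pi> e0 g)"
    unfolding deck_action_def by (rule someI[of ?P])
  then obtain \<gamma> where \<gamma>: "pathin E \<gamma>" "\<gamma> 0 = e0" "path_class (\<pi> \<circ> \<gamma>) = g" "deck_action E \<pi> e0 g e0 = \<gamma> 1"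
    by blast
  have "path (\<pi> \<circ> \<gamma>)"
    using continuous_map_compose[OF \<gamma>(1)[unfolded pathin_def] continuous_map_projection]
    by (simp add: path_def)
  moreover have "transport (\<pi> \<circ> \<gamma>) e0 = \<gamma> 1"
    using transport_equality[OF \<gamma>(1), of "\<pi> \<circ> \<gamma>"] \<gamma>(2) by simp
  moreover have "\<pi> (\<gamma> 1) = \<pi> e0"
    using P \<gamma>(4) e0 unfolding deck_transformation_def by metis
  ultimately show thesis
    using that[of "\<pi> \<circ> \<gamma>"] P \<gamma> by (simp add: pathstart_def pathfinish_def)
qed

end

section \<open>Covers with prescribed covering group\<close>

text \<open>The relation says that \<open>\<gamma>\<close> and \<open>\<gamma>'\<close> lie in the same right coset of \<open>K\<close>, extended from loops to paths with
a common end. It contains homotopy, and it is trivial on balls of radius \<open>\<delta>\<close> since the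
classes of lassos with small loops belong to \<open>K\<close>.\<close>

lemma path_congruence_subgroup:
  fixes p :: "'a::metric_space"
  assumes ls: "length_space TYPE('a)" and K: "subgroup K (fundamental_group p)"
    and \<delta>: "\<delta> > 0" and gens: "cutoff_generators p \<delta> R \<subseteq> K"
  shows "path_congruence p (\<lambda>\<gamma> \<gamma>'. path \<gamma> \<and> pathstart \<gamma> = p \<and> path \<gamma>' \<and> pathstart \<gamma>' = p \<and>
     pathfinish \<gamma> = pathfinish \<gamma>' \<and> path_class (\<gamma> +++ reversepath \<gamma>') \<in> K)"
    (is "path_congruence p ?rel")
proof -
  have hom: "?rel \<gamma> \<gamma>'" if h: "homotopic \<gamma> \<gamma>'" and p: "pathstart \<gamma> = p" for \<gamma> \<gamma>'
  proof -
    have *: "path \<gamma>" "path \<gamma>'" "pathstart \<gamma>' = p" "pathfinish \<gamma>' = pathfinish \<gamma>"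
      using h p homotopic_paths_imp_path[OF h] homotopic_paths_imp_pathstart[OF h]
        homotopic_paths_imp_pathfinish[OF h] by auto
    have "homotopic (\<gamma> +++ reversepath \<gamma>') (\<gamma>' +++ reversepath \<gamma>')"
      using h * by (intro homotopic_cong_left) auto
    also have "homotopic \<dots> (\<lambda>_. p)"
      using homotopic_reverse_right[OF *(2)] * by simp
    finally have "path_class (\<gamma> +++ reversepath \<gamma>') = \<one>\<^bsub>fundamental_group p\<^esub>"
      by (simp add: path_class_eqI one_fundamental_group)
    then show ?thesis
      using * p subgroup.one_closed[OF K] by simp
  qed
  show ?thesis
  proof
    show "length_space TYPE('a)" by (rule ls)
  next
    fix \<gamma> \<gamma>' assume *: "?rel \<gamma> \<gamma>'"
    have "inv\<^bsub>fundamental_group p\<^esub> (path_class (\<gamma> +++ reversepath \<gamma>')) \<in> K"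
      by (rule subgroup.m_inv_closed[OF K]) (use * in blast)
    moreover have "inv\<^bsub>fundamental_group p\<^esub> (path_class (\<gamma> +++ reversepath \<gamma>')) = path_class (\<gamma>' +++ reversepath \<gamma>)"
      using * by (subst inv_path_class) (auto simp: reversepath_joinpaths)
    ultimately show "?rel \<gamma>' \<gamma>" using * by simp
  next
    fix \<gamma> \<gamma>' \<gamma>'' assume *: "?rel \<gamma> \<gamma>'" "?rel \<gamma>' \<gamma>''"
    have "path_class (\<gamma> +++ reversepath \<gamma>') \<otimes>\<^bsub>fundamental_group p\<^esub> path_class (\<gamma>' +++ reversepath \<gamma>'') \<in> K"
      by (rule subgroup.m_closed[OF K]) (use * in blast)+
    moreover have "path_class (\<gamma> +++ reversepath \<gamma>') \<otimes>\<^bsub>fundamental_group p\<^esub> path_class (\<gamma>' +++ reversepath \<gamma>'') =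
        path_class ((\<gamma> +++ reversepath \<gamma>') +++ (\<gamma>' +++ reversepath \<gamma>''))"
      using * by (intro mult_path_class) auto
    moreover have "homotopic ((\<gamma> +++ reversepath \<gamma>') +++ (\<gamma>' +++ reversepath \<gamma>'')) (\<gamma> +++ reversepath \<gamma>'')"
      using homotopic_cancel_middle[of \<gamma> "reversepath \<gamma>''" "reversepath \<gamma>'"] * by simp
    ultimately show "?rel \<gamma> \<gamma>''"
      using * by (auto dest: path_class_eqI)
  next
    fix \<gamma> \<gamma>' \<rho> assume *: "?rel \<gamma> \<gamma>'" "path \<rho>" "pathstart \<rho> = pathfinish \<gamma>"
    have "homotopic ((\<gamma> +++ \<rho>) +++ (reversepath \<rho> +++ reversepath \<gamma>')) (\<gamma> +++ reversepath \<gamma>')"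
      using * by (intro homotopic_cancel_middle) auto
    then have "path_class ((\<gamma> +++ \<rho>) +++ reversepath (\<gamma>' +++ \<rho>)) = path_class (\<gamma> +++ reversepath \<gamma>')"
      using * by (simp add: reversepath_joinpaths path_class_eqI)
    then show "?rel (\<gamma> +++ \<rho>) (\<gamma>' +++ \<rho>)"
      using * by simp
  next
    fix \<gamma> \<rho> and s t :: real
    assume *: "path \<gamma>" "pathstart \<gamma> = p" "path \<rho>" "pathstart \<rho> = pathfinish \<gamma>" "s \<in> {0..1}" "t \<in> {0..1}"
    have zero: "(0::real) \<in> {0..1}" by simp
    have \<rho>0: "\<rho> 0 = pathfinish \<gamma>"
      using *(4) by (simp add: pathstart_def)
    note segs = path_segment[OF *(3) zero *(5)] path_segment[OF *(3) *(5,6)]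
    have "homotopic ((\<gamma> +++ (\<rho> \<circ> linepath 0 s)) +++ (\<rho> \<circ> linepath s t))
        (\<gamma> +++ ((\<rho> \<circ> linepath 0 s) +++ (\<rho> \<circ> linepath s t)))"
      using * segs \<rho>0 by (intro homotopic_assoc) auto
    also have "homotopic \<dots> (\<gamma> +++ (\<rho> \<circ> linepath 0 t))"
      using * segs \<rho>0 by (intro homotopic_cong_right homotopic_segments) auto
    finally show "?rel ((\<gamma> +++ (\<rho> \<circ> linepath 0 s)) +++ (\<rho> \<circ> linepath s t)) (\<gamma> +++ (\<rho> \<circ> linepath 0 t))"
      by (rule hom) (use * in simp)
  next
    fix x
    have "?rel (\<gamma> +++ \<rho>) (\<gamma> +++ \<rho>')"
      if *: "path \<gamma>" "pathstart \<gamma> = p" "path \<rho>" "path \<rho>'" "pathstart \<rho> = pathfinish \<gamma>"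
        "pathstart \<rho>' = pathfinish \<gamma>" "pathfinish \<rho> = pathfinish \<rho>'" "path_image \<rho> \<subseteq> ball x \<delta>"
        "path_image \<rho>' \<subseteq> ball x \<delta>" for \<gamma> \<rho> \<rho>'
    proof -
      \<comment> \<open>The quotient of the two paths is a conjugate of the small loop \<open>\<rho> +++ reversepath \<rho>'\<close>.\<close>
      have "path_image (\<rho> +++ reversepath \<rho>') \<subseteq> ball x \<delta>"
        using * by (simp add: path_image_join)
      then have "path_class (\<gamma> +++ (\<rho> +++ reversepath \<rho>') +++ reversepath \<gamma>) \<in> cutoff_generators p \<delta> R"
        unfolding cutoff_generators_def using *
        by (intro CollectI exI[of _ \<gamma>] exI[of _ "\<rho> +++ reversepath \<rho>'"]) auto
      moreover have "homotopic ((\<gamma> +++ \<rho>) +++ (reversepath \<rho>' +++ reversepath \<gamma>))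
          (\<gamma> +++ (\<rho> +++ (reversepath \<rho>' +++ reversepath \<gamma>)))"
        using * by (intro homotopic_assoc) auto
      moreover have "homotopic (\<gamma> +++ ((\<rho> +++ reversepath \<rho>') +++ reversepath \<gamma>))
          (\<gamma> +++ (\<rho> +++ (reversepath \<rho>' +++ reversepath \<gamma>)))"
        using * by (intro homotopic_cong_right homotopic_assoc) auto
      ultimately show ?thesis
        using * gens by (simp add: reversepath_joinpaths) (metis path_class_eqI subsetD)
    qed
    with \<delta> show "\<exists>r>0. \<forall>\<gamma> \<rho> \<rho>'. path \<gamma> \<and> pathstart \<gamma> = p \<and> path \<rho> \<and> path \<rho>' \<and>
      pathstart \<rho> = pathfinish \<gamma> \<and> pathstart \<rho>' = pathfinish \<gamma> \<and> pathfinish \<rho> = pathfinish \<rho>' \<and>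
      path_image \<rho> \<subseteq> ball x r \<and> path_image \<rho>' \<subseteq> ball x r \<longrightarrow> ?rel (\<gamma> +++ \<rho>) (\<gamma> +++ \<rho>')"
      by (intro exI[of _ \<delta>]) simp
  next
    show "?rel \<gamma> \<gamma>" if "path \<gamma>" "pathstart \<gamma> = p" for \<gamma>
      by (rule hom) (use that in auto)
    show "?rel ((\<gamma> +++ \<rho>) +++ \<rho>') (\<gamma> +++ (\<rho> +++ \<rho>'))"
      if "path \<gamma>" "pathstart \<gamma> = p" "path \<rho>" "path \<rho>'" "pathstart \<rho> = pathfinish \<gamma>"
        "pathstart \<rho>' = pathfinish \<rho>" for \<gamma> \<rho> \<rho>'
      by (rule hom) (use that in \<open>auto intro: homotopic_assoc\<close>)
    show "?rel ((\<gamma> +++ \<rho>) +++ reversepath \<rho>) \<gamma>"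
      if "path \<gamma>" "pathstart \<gamma> = p" "path \<rho>" "pathstart \<rho> = pathfinish \<gamma>" for \<gamma> \<rho>
      by (rule hom) (use that in \<open>auto intro: homotopic_cancel\<close>)
    show "?rel (\<gamma> +++ (\<lambda>_. pathfinish \<gamma>)) \<gamma>" if "path \<gamma>" "pathstart \<gamma> = p" for \<gamma>
      by (rule hom) (use that in \<open>auto intro: homotopic_unit_right\<close>)
    show "?rel ((\<lambda>_. p) +++ \<gamma>) \<gamma>" if "path \<gamma>" "pathstart \<gamma> = p" for \<gamma>
      by (rule hom) (use that in \<open>auto intro: homotopic_unit_left simp: path_const\<close>)
  qed blast
qed

text \<open>A loop lifts to a closed path at the class of the constant path exactly if its class is in \<open>K\<close>.\<close>

lemma cover_with_covering_group:
  fixes p :: "'a::metric_space"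
  assumes ls: "length_space TYPE('a)" and K: "subgroup K (fundamental_group p)"
    and \<delta>: "\<delta> > 0" and gens: "cutoff_generators p \<delta> R \<subseteq> K"
  obtains E :: "(real \<Rightarrow> 'a) set topology" and q e
  where "cover_of_space E q" "e \<in> topspace E" "q e = p" "covering_group E q e = K"
proof -
  define rel where "rel \<gamma> \<gamma>' \<longleftrightarrow> path \<gamma> \<and> pathstart \<gamma> = p \<and> path \<gamma>' \<and> pathstart \<gamma>' = p \<and>
     pathfinish \<gamma> = pathfinish \<gamma>' \<and> path_class (\<gamma> +++ reversepath \<gamma>') \<in> K" for \<gamma> \<gamma>'
  interpret C: path_congruence p rel
    unfolding rel_def using path_congruence_subgroup[OF assms] .
  let ?e = "C.cls (\<lambda>_. p)"
  have based: "C.based (\<lambda>_. p)"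
    by (simp add: C.based_def path_const)
  then have e: "?e \<in> topspace C.cover" "C.endpoint ?e = p"
    by (simp_all add: C.topspace_cover C.endpoint_cls path_const)
  have closed: "C.transport \<gamma> ?e = ?e \<longleftrightarrow> path_class \<gamma> \<in> K"
    if \<gamma>: "path \<gamma>" "pathstart \<gamma> = p" "pathfinish \<gamma> = p" for \<gamma>
  proof -
    have "homotopic (((\<lambda>_. p) +++ \<gamma>) +++ (\<lambda>_. p)) ((\<lambda>_. p) +++ \<gamma>)"
      using \<gamma> by (intro homotopic_unit_right) (auto simp: path_const)
    also have "homotopic \<dots> \<gamma>"
      using \<gamma> by (intro homotopic_unit_left) auto
    finally have "path_class (((\<lambda>_. p) +++ \<gamma>) +++ (\<lambda>_. p)) = path_class \<gamma>"
      by (rule path_class_eqI)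
    moreover have "reversepath (\<lambda>_. p) = (\<lambda>_. p)"
      by (simp add: reversepath_def)
    ultimately have "rel ((\<lambda>_. p) +++ \<gamma>) (\<lambda>_. p) \<longleftrightarrow> path_class \<gamma> \<in> K"
      using \<gamma> unfolding rel_def by (simp add: path_const)
    then show ?thesis
      using C.transport_cls[OF based \<gamma>(1)] \<gamma>(2) C.cls_eq_iff[OF based] by (simp add: path_const)
  qed
  have "covering_group C.cover C.endpoint ?e = K"
  proof (intro equalityI subsetI)
    fix g assume "g \<in> covering_group C.cover C.endpoint ?e"
    then obtain \<sigma> where \<sigma>: "g = path_class (C.endpoint \<circ> \<sigma>)" "pathin C.cover \<sigma>" "\<sigma> 0 = ?e" "\<sigma> 1 = ?e"
      unfolding covering_group_def by blast
    have "path (C.endpoint \<circ> \<sigma>)"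
      using continuous_map_compose[OF \<sigma>(2)[unfolded pathin_def] C.continuous_map_projection]
      by (simp add: path_def)
    moreover have "C.transport (C.endpoint \<circ> \<sigma>) ?e = ?e"
      using C.transport_equality[OF \<sigma>(2), of "C.endpoint \<circ> \<sigma>"] \<sigma>(3,4) by simp
    ultimately show "g \<in> K"
      using closed[of "C.endpoint \<circ> \<sigma>"] \<sigma> e(2) by (simp add: pathstart_def pathfinish_def)
  next
    fix g assume "g \<in> K"
    then have "g \<in> carrier (fundamental_group p)"
      using subgroup.subset[OF K] by blast
    then obtain \<gamma> where \<gamma>: "g = path_class \<gamma>" "path \<gamma>" "pathstart \<gamma> = p" "pathfinish \<gamma> = p"
      by (rule path_class_loopE)
    note \<gamma>e = \<gamma>(2) e(1) trans[OF e(2) \<gamma>(3)[symmetric]]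
    have "C.lift \<gamma> ?e 1 = ?e"
      using closed[OF \<gamma>(2-4)] \<gamma>(1) \<open>g \<in> K\<close> by (simp add: C.transport_def)
    moreover have "path_class (C.endpoint \<circ> C.lift \<gamma> ?e) = g"
      using path_class_cong[OF \<gamma>(2), of "C.endpoint \<circ> C.lift \<gamma> ?e"] C.projection_lift[OF \<gamma>e] \<gamma>(1) by simp
    ultimately show "g \<in> covering_group C.cover C.endpoint ?e"
      unfolding covering_group_def using C.pathin_lift[OF \<gamma>e] C.lift_0[OF \<gamma>e] by blast
  qed
  moreover have "cover_of_space C.cover C.endpoint"
    by (simp add: cover_of_space_def C.connected_space_cover C.covering_map_cover)
  ultimately show thesis
    using that e by blast
qed

lemma subgroup_normal_closure:
  assumes "group G" "S \<subseteq> carrier G"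
  shows "subgroup (normal_closure G S) G"
  unfolding normal_closure_def
proof (rule group.subgroups_Inter[OF assms(1)])
  show "{N. N \<lhd> G \<and> S \<subseteq> N} \<noteq> {}"
    using group.normal_self[OF assms(1)] assms(2) by blast
qed (auto simp: normal_def)

lemma cutoff_cover_exists:
  fixes p :: "'a::metric_space"
  assumes "length_space TYPE('a)" "\<delta> > 0"
  obtains E :: "(real \<Rightarrow> 'a) set topology" and q where "is_cutoff_cover p \<delta> R E q"
proof -
  let ?N = "normal_closure (fundamental_group p) (cutoff_generators p \<delta> R)"
  have "subgroup ?N (fundamental_group p)"
    by (rule subgroup_normal_closure[OF group_fundamental_group cutoff_generators_subset])
  moreover have "cutoff_generators p \<delta> R \<subseteq> ?N"
    unfolding normal_closure_def by blast
  ultimately obtain E :: "(real \<Rightarrow> 'a) set topology" and q e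
    where "cover_of_space E q" "e \<in> topspace E" "q e = p" "covering_group E q e = ?N"
    using cover_with_covering_group[OF assms(1) _ assms(2)] by metis
  then have "is_cutoff_cover p \<delta> R E q"
    unfolding is_cutoff_cover_def by blast
  then show thesis by (rule that)
qed

section \<open>Rescaled displacement of deck transformations\<close>

lemma Lim_at_top_mono:
  fixes F :: "real \<Rightarrow> ennreal"
  assumes "mono F"
  shows "Lim at_top F = (SUP R. F R)"
proof (rule tendsto_Lim)
  show "(F \<longlongrightarrow> (SUP R. F R)) at_top"
  proof (rule order_tendstoI)
    fix a assume "a < (SUP R. F R)"
    then obtain R where "a < F R"
      by (auto simp: less_SUP_iff)
    then have "a < F R'" if "R \<le> R'" for R'
      using monoD[OF assms that] by (rule order_less_le_trans)
    then show "\<forall>\<^sub>F R in at_top. a < F R"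
      unfolding eventually_at_top_linorder by blast
  next
    fix a assume a: "(SUP R. F R) < a"
    have "F R < a" for R
      by (rule order_le_less_trans[OF SUP_upper a]) simp
    then show "\<forall>\<^sub>F R in at_top. F R < a"
      by simp
  qed
qed simp

text \<open>The infimum is taken over smaller and smaller sets as \<open>R\<close> grows.\<close>

lemma inf_rescaled_length_eq_SUP:
  "inf_rescaled_length E \<pi> e0 x0 g =
     (SUP R::real. INF e \<in> {e \<in> topspace E. \<pi> e \<notin> ball x0 R}.
        lifted_dist E \<pi> (deck_action E \<pi> e0 g e) e / ennreal (dist (\<pi> e) x0))"
  unfolding inf_rescaled_length_def
  by (intro Lim_at_top_mono monoI INF_superset_mono) auto

text \<open>The infima increase to a limit below \<open>2\<close>, so a single constant \<open>r < 2\<close> works at all distances. The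
uniformity matters: it keeps short loops away from the base point by a fixed fraction of their
distance.\<close>

lemma small_displacement_far_out:
  assumes "inf_rescaled_length E \<pi> e0 x0 g < 2"
  obtains r where "0 \<le> r" "r < 2"
    "\<And>R. R > 0 \<Longrightarrow> \<exists>e\<in>topspace E. R \<le> dist (\<pi> e) x0 \<and>
       lifted_dist E \<pi> (deck_action E \<pi> e0 g e) e < ennreal (r * dist (\<pi> e) x0)"
proof -
  let ?F = "\<lambda>e. lifted_dist E \<pi> (deck_action E \<pi> e0 g e) e / ennreal (dist (\<pi> e) x0)"
  obtain c where c: "inf_rescaled_length E \<pi> e0 x0 g < c" "c < 2"
    using dense[OF assms] by blast
  obtain r where r: "0 \<le> r" "c = ennreal r"
    using c(2) by (cases c) auto
  have "r < 2"
    using c(2) r by (metis ennreal_less_iff ennreal_numeral)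
  have "\<exists>e\<in>topspace E. R \<le> dist (\<pi> e) x0 \<and>
       lifted_dist E \<pi> (deck_action E \<pi> e0 g e) e < ennreal (r * dist (\<pi> e) x0)" if R: "R > 0" for R
  proof -
    have "(INF e \<in> {e \<in> topspace E. \<pi> e \<notin> ball x0 R}. ?F e) \<le> inf_rescaled_length E \<pi> e0 x0 g"
      unfolding inf_rescaled_length_eq_SUP by (rule SUP_upper) simp
    then have "(INF e \<in> {e \<in> topspace E. \<pi> e \<notin> ball x0 R}. ?F e) < c"
      using c(1) by (rule order_le_less_trans)
    then obtain e where e: "e \<in> topspace E" "\<pi> e \<notin> ball x0 R" "?F e < c"
      by (auto simp: INF_less_iff)
    have d: "R \<le> dist (\<pi> e) x0"
      using e(2) by (simp add: dist_commute)
    have "lifted_dist E \<pi> (deck_action E \<pi> e0 g e) e < ennreal (r * dist (\<pi> e) x0)"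
    proof (rule ccontr)
      assume "\<not> ?thesis"
      then have "ennreal (r * dist (\<pi> e) x0) / ennreal (dist (\<pi> e) x0) \<le> ?F e"
        by (intro divide_right_mono_ennreal) simp
      moreover have "ennreal (r * dist (\<pi> e) x0) / ennreal (dist (\<pi> e) x0) = c"
        using d R r by (subst divide_ennreal) auto
      ultimately show False
        using e(3) by simp
    qed
    with e(1) d show ?thesis by blast
  qed
  with that[OF r(1) \<open>r < 2\<close>] show thesis by blast
qed

context universal_length_cover
begin

lemma lifted_dist_transport_le:
  assumes "path \<rho>" "e \<in> topspace E" "\<pi> e = pathstart \<rho>"
  shows "lifted_dist E \<pi> e (transport \<rho> e) \<le> curve_length \<rho>"
proof -
  have "lifted_dist E \<pi> e (transport \<rho> e) \<le> curve_length (\<pi> \<circ> lift \<rho> e)"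
    unfolding lifted_dist_def transport_def
    by (rule INF_lower) (use pathin_lift[OF assms] lift_0[OF assms] in simp)
  also have "\<dots> = curve_length \<rho>"
    by (rule curve_length_cong) (use projection_lift[OF assms] in simp)
  finally show ?thesis .
qed

lemma transport_deck_transformation:
  assumes h: "deck_transformation E \<pi> h" and \<rho>: "path \<rho>" "e \<in> topspace E" "\<pi> e = pathstart \<rho>"
  shows "transport \<rho> (h e) = h (transport \<rho> e)"
  by (rule transport_morphism[OF covering_axioms])
     (use h \<rho> in \<open>auto simp: deck_transformation_def homeomorphic_imp_continuous_map\<close>)

lemma deck_transformation_topspace:
  assumes "deck_transformation E \<pi> h" "e \<in> topspace E"
  shows "h e \<in> topspace E" "\<pi> (h e) = \<pi> e"
  using assms homeomorphic_imp_surjective_map[of E E h] by (auto simp: deck_transformation_def)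

text \<open>If \<open>e\<close> is reached from \<open>e0\<close> by the lift of a geodesic to \<open>x\<close>, then its displacement is at most twice
the length of the geodesic plus the constant displacement of \<open>e0\<close>, and that length differs
from \<open>dist x x0\<close> by a bounded amount.\<close>

lemma inf_rescaled_length_le_2:
  assumes e0: "e0 \<in> topspace E" and g: "g \<in> carrier (fundamental_group (\<pi> e0))"
    and unbounded: "\<not> bounded (UNIV :: 'a set)"
  shows "inf_rescaled_length E \<pi> e0 x0 g \<le> 2"
  unfolding inf_rescaled_length_eq_SUP
proof (rule SUP_least)
  fix R :: real
  define h where "h = deck_action E \<pi> e0 g"
  have h: "deck_transformation E \<pi> h"
    unfolding h_def using deck_action_lift[OF e0 g] by blast
  note h_top = deck_transformation_topspace[OF h]
  obtain c where c: "path c" "pathstart c = \<pi> e0" "transport c e0 = h e0" "curve_length c < \<infinity>"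
    using rectifiable_transport[OF e0 h_top(1)[OF e0]] by blast
  obtain C where C: "C \<ge> 0" "curve_length c = ennreal C"
    using c(4) by (cases "curve_length c") auto
  have c_fin: "pathfinish c = \<pi> e0"
    using projection_transport[of c e0] c e0 h_top by simp
  define K where "K = 2 * dist (\<pi> e0) x0 + C"
  have "K \<ge> 0" using C by (simp add: K_def)
  show "(INF e \<in> {e \<in> topspace E. \<pi> e \<notin> ball x0 R}.
      lifted_dist E \<pi> (deck_action E \<pi> e0 g e) e / ennreal (dist (\<pi> e) x0)) \<le> 2" (is "?I \<le> 2")
  proof (rule ennreal_le_epsilon)
    fix \<epsilon> :: real assume \<epsilon>: "\<epsilon> > 0"
    define M where "M = max 1 (max R (K / \<epsilon>))"
    obtain x where "dist x0 x > M"
      using unbounded unfolding bounded_def by (metis UNIV_I not_le)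
    then have x: "dist x x0 \<ge> 1" "dist x x0 \<ge> R" "dist x x0 \<ge> K / \<epsilon>"
      by (auto simp: M_def dist_commute)
    obtain \<rho> where \<rho>: "path \<rho>" "pathstart \<rho> = \<pi> e0" "pathfinish \<rho> = x"
        "curve_length \<rho> = ennreal (dist (\<pi> e0) x)"
      using length_space_geodesic[OF length_space, of "\<pi> e0" x] by metis
    define e where "e = transport \<rho> e0"
    have e: "e \<in> topspace E" "\<pi> e = x"
      unfolding e_def using transport_topspace[of \<rho> e0] projection_transport[of \<rho> e0] \<rho> e0 by auto
    \<comment> \<open>Go back from \<open>h e\<close> to \<open>h e0\<close> along the translate of the lifted geodesic, on to \<open>e0\<close>, and out
      to \<open>e\<close> along the lifted geodesic.\<close>
    let ?w = "(reversepath \<rho> +++ reversepath c) +++ \<rho>"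
    have "transport (reversepath \<rho>) (h e) = h e0"
      using transport_reversepath[of \<rho> "h e0"] transport_deck_transformation[OF h \<rho>(1) e0] \<rho>(1,2) e0 h_top
      by (simp add: e_def)
    moreover have "transport (reversepath c) (h e0) = e0"
      using transport_reversepath[of c e0] c e0 by simp
    ultimately have w: "transport ?w (h e) = e"
      using \<rho> c c_fin e h_top by (simp add: transport_join e_def)
    have "curve_length ?w \<le> curve_length (reversepath \<rho> +++ reversepath c) + curve_length \<rho>"
      by (rule curve_length_join_le) (use \<rho> c c_fin in simp)
    also have "\<dots> \<le> (curve_length (reversepath \<rho>) + curve_length (reversepath c)) + curve_length \<rho>"
      by (intro add_right_mono curve_length_join_le) (use \<rho> c_fin in simp)
    also have "\<dots> \<le> (curve_length \<rho> + curve_length c) + curve_length \<rho>"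
      by (intro add_right_mono add_mono curve_length_reversepath_le)
    also have "\<dots> = ennreal (2 * dist (\<pi> e0) x + C)"
      using \<rho>(4) C by (simp flip: ennreal_plus)
    also have "\<dots> \<le> ennreal (2 * dist x x0 + K)"
      using dist_triangle[of "\<pi> e0" x x0] by (intro ennreal_leI) (simp add: K_def dist_commute)
    finally have "lifted_dist E \<pi> (h e) e \<le> ennreal (2 * dist x x0 + K)"
      using lifted_dist_transport_le[of ?w "h e"] w \<rho> c c_fin e h_top by simp
    then have "lifted_dist E \<pi> (h e) e / ennreal (dist x x0) \<le> ennreal (2 * dist x x0 + K) / ennreal (dist x x0)"
      by (rule divide_right_mono_ennreal)
    also have "\<dots> = ennreal ((2 * dist x x0 + K) / dist x x0)"
      using x(1) \<open>K \<ge> 0\<close> by (intro divide_ennreal) auto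
    also have "\<dots> \<le> ennreal (2 + \<epsilon>)"
    proof (rule ennreal_leI)
      have "K \<le> \<epsilon> * dist x x0"
        using x(3) \<epsilon> by (simp add: field_simps)
      moreover have "dist x x0 > 0"
        using x(1) by linarith
      ultimately show "(2 * dist x x0 + K) / dist x x0 \<le> 2 + \<epsilon>"
        by (simp add: field_simps)
    qed
    also have "\<dots> = 2 + ennreal \<epsilon>"
      using \<epsilon> by (simp add: ennreal_plus)
    finally have "lifted_dist E \<pi> (deck_action E \<pi> e0 g e) e / ennreal (dist (\<pi> e) x0) \<le> 2 + ennreal \<epsilon>"
      using e(2) by (simp add: h_def)
    moreover have "e \<in> {e \<in> topspace E. \<pi> e \<notin> ball x0 R}"
      using e x(2) by (simp add: dist_commute)
    ultimately show "?I \<le> 2 + ennreal \<epsilon>"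
      by (rule INF_lower2[rotated])
  qed
qed

end

section \<open>Loops far out\<close>

text \<open>In the notation of words, \<open>a c a' \<cdot> a s t s' a' = a (c s t s') a'\<close>.\<close>

lemma homotopic_conjugate_product:
  fixes a :: "real \<Rightarrow> 'a::metric_space"
  assumes "path a" "path c" "path s" "path t" "pathfinish a = pathstart c" "pathfinish c = pathstart s"
    "pathstart s = pathfinish a" "pathstart t = pathfinish s" "pathfinish t = pathfinish s"
  shows "homotopic ((a +++ (c +++ reversepath a)) +++ ((a +++ s) +++ (t +++ reversepath (a +++ s))))
     (a +++ ((c +++ (s +++ (t +++ reversepath s))) +++ reversepath a))"
proof -
  let ?a = "reversepath a" and ?s = "reversepath s"
  let ?X = "s +++ (t +++ (?s +++ ?a))"
  have rev: "reversepath (a +++ s) = ?s +++ ?a"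
    using assms by (simp add: reversepath_joinpaths)
  have "homotopic ((a +++ (c +++ ?a)) +++ ((a +++ s) +++ (t +++ (?s +++ ?a)))) (((a +++ c) +++ ?a) +++ (a +++ ?X))"
    using assms by (intro homotopic_paths_join homotopic_assoc homotopic_paths_sym[OF homotopic_assoc]) auto
  also have "homotopic \<dots> ((a +++ c) +++ ?X)"
    using homotopic_cancel_middle[of "a +++ c" ?X ?a] assms by simp
  also have "homotopic \<dots> (a +++ (c +++ ?X))"
    using assms by (intro homotopic_assoc) auto
  finally have 1: "homotopic ((a +++ (c +++ ?a)) +++ ((a +++ s) +++ (t +++ (?s +++ ?a)))) (a +++ (c +++ ?X))" .
  have "homotopic ((c +++ (s +++ (t +++ ?s))) +++ ?a) (c +++ ((s +++ (t +++ ?s)) +++ ?a))"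
    using assms by (intro homotopic_assoc) auto
  also have "homotopic \<dots> (c +++ (s +++ ((t +++ ?s) +++ ?a)))"
    using assms by (intro homotopic_cong_right homotopic_assoc) auto
  also have "homotopic \<dots> (c +++ ?X)"
    using assms by (intro homotopic_cong_right homotopic_assoc) auto
  finally have "homotopic (a +++ ((c +++ (s +++ (t +++ ?s))) +++ ?a)) (a +++ (c +++ ?X))"
    using assms by (intro homotopic_cong_right) auto
  then show ?thesis
    unfolding rev using 1 homotopic_paths_sym homotopic_paths_trans by blast
qed

text \<open>The isomorphism of fundamental groups along a path \<open>a\<close> from the new base point to the old one.\<close>

definition base_change :: "(real \<Rightarrow> 'a::metric_space) \<Rightarrow> (real \<Rightarrow> 'a) set \<Rightarrow> (real \<Rightarrow> 'a) set" where
  "base_change a g = (\<Union>\<gamma>\<in>g. path_class (a +++ (\<gamma> +++ reversepath a)))"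

lemma base_change_path_class:
  assumes "path a" "path \<gamma>" "pathstart \<gamma> = pathfinish a" "pathfinish \<gamma> = pathfinish a"
  shows "base_change a (path_class \<gamma>) = path_class (a +++ (\<gamma> +++ reversepath a))"
proof -
  have "path_class (a +++ (\<gamma>' +++ reversepath a)) = path_class (a +++ (\<gamma> +++ reversepath a))"
    if "\<gamma>' \<in> path_class \<gamma>" for \<gamma>'
  proof -
    have "homotopic \<gamma> \<gamma>'" using that by (simp add: path_class_def)
    then have "homotopic (a +++ (\<gamma> +++ reversepath a)) (a +++ (\<gamma>' +++ reversepath a))"
      using assms by (intro homotopic_cong_right homotopic_cong_left) auto
    then show ?thesis
      by (rule path_class_eqI[symmetric])
  qed
  moreover have "\<gamma> \<in> path_class \<gamma>"
    using assms by (simp add: path_class_def)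
  ultimately show ?thesis
    unfolding base_change_def by blast
qed

lemma base_change_hom:
  fixes a :: "real \<Rightarrow> 'a::metric_space"
  assumes a: "path a" "pathstart a = p" "pathfinish a = b"
  shows "group_hom (fundamental_group b) (fundamental_group p) (base_change a)"
proof -
  have "base_change a \<in> hom (fundamental_group b) (fundamental_group p)"
  proof (rule homI)
    fix x assume "x \<in> carrier (fundamental_group b)"
    then show "base_change a x \<in> carrier (fundamental_group p)"
      using a by (elim path_class_loopE) (auto simp: base_change_path_class intro!: path_class_loopI)
  next
    fix x y assume "x \<in> carrier (fundamental_group b)" "y \<in> carrier (fundamental_group b)"
    then obtain \<gamma> \<gamma>' where \<gamma>: "x = path_class \<gamma>" "path \<gamma>" "pathstart \<gamma> = b" "pathfinish \<gamma> = b"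
      and \<gamma>': "y = path_class \<gamma>'" "path \<gamma>'" "pathstart \<gamma>' = b" "pathfinish \<gamma>' = b"
      by (elim path_class_loopE)
    let ?a = "reversepath a"
    have "homotopic ((a +++ (\<gamma> +++ ?a)) +++ (a +++ (\<gamma>' +++ ?a))) (((a +++ \<gamma>) +++ ?a) +++ (a +++ (\<gamma>' +++ ?a)))"
      using a \<gamma> \<gamma>' by (intro homotopic_cong_left homotopic_paths_sym[OF homotopic_assoc]) auto
    also have "homotopic \<dots> ((a +++ \<gamma>) +++ (\<gamma>' +++ ?a))"
      using homotopic_cancel_middle[of "a +++ \<gamma>" "\<gamma>' +++ ?a" ?a] a \<gamma> \<gamma>' by simp
    also have "homotopic \<dots> (a +++ (\<gamma> +++ (\<gamma>' +++ ?a)))"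
      using a \<gamma> \<gamma>' by (intro homotopic_assoc) auto
    also have "homotopic \<dots> (a +++ ((\<gamma> +++ \<gamma>') +++ ?a))"
      using a \<gamma> \<gamma>' by (intro homotopic_cong_right homotopic_paths_sym[OF homotopic_assoc]) auto
    finally have "path_class (a +++ ((\<gamma> +++ \<gamma>') +++ ?a)) = path_class ((a +++ (\<gamma> +++ ?a)) +++ (a +++ (\<gamma>' +++ ?a)))"
      by (rule path_class_eqI[symmetric])
    then show "base_change a (x \<otimes>\<^bsub>fundamental_group b\<^esub> y) =
        base_change a x \<otimes>\<^bsub>fundamental_group p\<^esub> base_change a y"
      using a \<gamma> \<gamma>' by (simp add: mult_path_class base_change_path_class)
  qed
  then show ?thesis
    by (simp add: group_hom_def group_hom_axioms_def group_fundamental_group)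
qed

lemma base_change_surj:
  fixes a :: "real \<Rightarrow> 'a::metric_space"
  assumes a: "path a" "pathstart a = p" "pathfinish a = b"
    and k: "k \<in> carrier (fundamental_group p)"
  shows "k \<in> base_change a ` carrier (fundamental_group b)"
proof -
  obtain \<gamma> where \<gamma>: "k = path_class \<gamma>" "path \<gamma>" "pathstart \<gamma> = p" "pathfinish \<gamma> = p"
    using k by (rule path_class_loopE)
  let ?a = "reversepath a"
  let ?\<mu> = "(?a +++ \<gamma>) +++ a"
  have "homotopic (a +++ (?\<mu> +++ ?a)) (a +++ (?a +++ \<gamma>))"
    using a \<gamma> by (intro homotopic_cong_right homotopic_cancel) auto
  also have "homotopic \<dots> ((a +++ ?a) +++ \<gamma>)"
    using a \<gamma> by (intro homotopic_paths_sym[OF homotopic_assoc]) auto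
  also have "homotopic \<dots> ((\<lambda>_. p) +++ \<gamma>)"
    using homotopic_reverse_right[OF a(1)] a \<gamma> by (intro homotopic_cong_left) auto
  also have "homotopic \<dots> \<gamma>"
    using \<gamma> by (intro homotopic_unit_left)
  finally have "k = base_change a (path_class ?\<mu>)"
    using a \<gamma> by (simp add: base_change_path_class path_class_eqI)
  moreover have "path_class ?\<mu> \<in> carrier (fundamental_group b)"
    using a \<gamma> by (intro path_class_loopI) auto
  ultimately show ?thesis by blast
qed

context universal_length_cover
begin

text \<open>Universality yields membership for conjugation by some path \<open>\<gamma>\<close> from \<open>p\<close> which cannot be controlled;
normality of \<open>N\<close> allows \<open>\<gamma>\<close> to be replaced by \<open>a\<close>.\<close>

lemma closed_lift_in_normal:
  assumes N: "N \<lhd> fundamental_group p" and \<delta>: "\<delta> > 0" and gens: "cutoff_generators p \<delta> R \<subseteq> N"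
    and e: "e \<in> topspace E" and \<rho>: "path \<rho>" "pathstart \<rho> = \<pi> e" and closed: "transport \<rho> e = e"
    and a: "path a" "pathstart a = p" "pathfinish a = \<pi> e"
  shows "path_class (a +++ (\<rho> +++ reversepath a)) \<in> N"
proof -
  have K: "subgroup N (fundamental_group p)"
    using N by (simp add: normal_def)
  have fin: "pathfinish \<rho> = \<pi> e"
    using projection_transport[of \<rho> e] \<rho> e closed by simp
  obtain \<gamma> where \<gamma>: "path \<gamma>" "pathstart \<gamma> = p" "pathfinish \<gamma> = \<pi> e"
    and mem: "path_class ((\<gamma> +++ \<rho>) +++ reversepath \<gamma>) \<in> N"
    using closed_lift_congruent[OF path_congruence_subgroup[OF length_space K \<delta> gens] \<rho> e closed] by metis
  let ?\<mu> = "a +++ reversepath \<gamma>" and ?\<nu> = "(\<gamma> +++ \<rho>) +++ reversepath \<gamma>"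
  have \<mu>: "path ?\<mu>" "pathstart ?\<mu> = p" "pathfinish ?\<mu> = p"
    using a \<gamma> by simp_all
  have "path_class ?\<mu> \<otimes>\<^bsub>fundamental_group p\<^esub> path_class ?\<nu> \<otimes>\<^bsub>fundamental_group p\<^esub>
      inv\<^bsub>fundamental_group p\<^esub> (path_class ?\<mu>) \<in> N"
    by (rule normal.inv_op_closed2[OF N path_class_loopI[OF \<mu>] mem])
  moreover have "path_class ?\<mu> \<otimes>\<^bsub>fundamental_group p\<^esub> path_class ?\<nu> \<otimes>\<^bsub>fundamental_group p\<^esub>
      inv\<^bsub>fundamental_group p\<^esub> (path_class ?\<mu>) = path_class ((?\<mu> +++ ?\<nu>) +++ (\<gamma> +++ reversepath a))"
    unfolding inv_path_class[OF \<mu>] using a \<gamma> \<rho> fin by (simp add: mult_path_class reversepath_joinpaths)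
  moreover have "homotopic ((?\<mu> +++ ?\<nu>) +++ (\<gamma> +++ reversepath a)) (a +++ (\<rho> +++ reversepath a))"
  proof -
    have "homotopic (?\<mu> +++ ?\<nu>) (?\<mu> +++ (\<gamma> +++ (\<rho> +++ reversepath \<gamma>)))"
      using a \<gamma> \<rho> fin by (intro homotopic_cong_right homotopic_assoc) auto
    also have "homotopic \<dots> (a +++ (\<rho> +++ reversepath \<gamma>))"
      using homotopic_cancel_middle[of a "\<rho> +++ reversepath \<gamma>" "reversepath \<gamma>"] a \<gamma> \<rho> fin by simp
    also have "homotopic \<dots> ((a +++ \<rho>) +++ reversepath \<gamma>)"
      using a \<gamma> \<rho> fin by (intro homotopic_paths_sym[OF homotopic_assoc]) auto
    finally have "homotopic ((?\<mu> +++ ?\<nu>) +++ (\<gamma> +++ reversepath a))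
        (((a +++ \<rho>) +++ reversepath \<gamma>) +++ (\<gamma> +++ reversepath a))"
      using a \<gamma> \<rho> fin by (intro homotopic_cong_left) auto
    also have "homotopic \<dots> ((a +++ \<rho>) +++ reversepath a)"
      using homotopic_cancel_middle[of "a +++ \<rho>" "reversepath a" "reversepath \<gamma>"] a \<gamma> \<rho> fin by simp
    also have "homotopic \<dots> (a +++ (\<rho> +++ reversepath a))"
      using a \<rho> fin by (intro homotopic_assoc) auto
    finally show ?thesis .
  qed
  ultimately show ?thesis
    using path_class_eqI by metis
qed

text \<open>Let \<open>c\<close> be a loop in the class \<open>g\<close>, \<open>s\<close> a path whose lift leads from \<open>e0\<close> to a far point \<open>e\<close> of small
displacement, and \<open>t\<close> the projection of a short path from the translate of \<open>e\<close> to \<open>e\<close>. Then \<open>c s t s'\<close> has a closed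
lift, and \<open>s t s'\<close> is a lasso whose loop lies outside the ball. So up to conjugation by \<open>a\<close> both are in \<open>N\<close>, and
therefore so is \<open>c\<close>.\<close>

lemma base_change_in_normal_if_short:
  assumes N: "N \<lhd> fundamental_group p" and \<delta>: "\<delta> > 0" and R: "R > 0"
    and gens: "cutoff_generators p \<delta> R \<subseteq> N"
    and e0: "e0 \<in> topspace E" and g: "g \<in> carrier (fundamental_group (\<pi> e0))"
    and short: "inf_rescaled_length E \<pi> e0 x0 g < 2"
    and a: "path a" "pathstart a = p" "pathfinish a = \<pi> e0"
  shows "base_change a g \<in> N"
proof -
  have K: "subgroup N (fundamental_group p)"
    using N by (simp add: normal_def)
  have mem_of_mult_mem: "x \<in> N"
    if "x \<otimes>\<^bsub>fundamental_group p\<^esub> y \<in> N" "y \<in> N" "x \<in> carrier (fundamental_group p)" for x y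
  proof -
    interpret G: group "fundamental_group p" by (rule group_fundamental_group)
    have y: "y \<in> carrier (fundamental_group p)"
      using subgroup.subset[OF K] that(2) by blast
    have "x = x \<otimes>\<^bsub>fundamental_group p\<^esub> y \<otimes>\<^bsub>fundamental_group p\<^esub> inv\<^bsub>fundamental_group p\<^esub> y"
      using that(3) y by (simp add: G.m_assoc)
    then show ?thesis
      using subgroup.m_closed[OF K that(1) subgroup.m_inv_closed[OF K that(2)]] by simp
  qed
  define h where "h = deck_action E \<pi> e0 g"
  obtain c where h: "deck_transformation E \<pi> h"
    and c: "path c" "pathstart c = \<pi> e0" "pathfinish c = \<pi> e0" "path_class c = g" "transport c e0 = h e0"
    using deck_action_lift[OF e0 g] unfolding h_def by metis
  note h_top = deck_transformation_topspace[OF h]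
  obtain r where r: "0 \<le> r" "r < 2"
    "\<And>R. R > 0 \<Longrightarrow> \<exists>e\<in>topspace E. R \<le> dist (\<pi> e) x0 \<and> lifted_dist E \<pi> (h e) e < ennreal (r * dist (\<pi> e) x0)"
    using small_displacement_far_out[OF short] unfolding h_def by metis
  define R' where "R' = (R + dist x0 p + 1) / (1 - r / 2)"
  have "R' > 0"
    using r(2) R by (auto simp: R'_def intro!: divide_pos_pos add_pos_nonneg)
  then obtain e where e: "e \<in> topspace E" "R' \<le> dist (\<pi> e) x0"
      "lifted_dist E \<pi> (h e) e < ennreal (r * dist (\<pi> e) x0)"
    using r(3) by blast
  let ?d = "dist (\<pi> e) x0"
  have far: "R + dist x0 p + 1 \<le> ?d * (1 - r / 2)"
    using e(2) r(2) by (simp add: R'_def field_simps)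
  obtain \<tau> where \<tau>: "pathin E \<tau>" "\<tau> 0 = h e" "\<tau> 1 = e" "curve_length (\<pi> \<circ> \<tau>) < ennreal (r * ?d)"
    using e(3) unfolding lifted_dist_def INF_less_iff by blast
  define t where "t = \<pi> \<circ> \<tau>"
  have t: "path t" "pathstart t = \<pi> e" "pathfinish t = \<pi> e"
    using continuous_map_compose[OF \<tau>(1)[unfolded pathin_def] continuous_map_projection] \<tau>(2,3) h_top(2)[OF e(1)]
    by (simp_all add: t_def path_def pathstart_def pathfinish_def)
  have t_lift: "transport t (h e) = e"
    using transport_equality[OF \<tau>(1), of t] \<tau>(2,3) by (simp add: t_def)
  \<comment> \<open>The loop \<open>t\<close> is shorter than twice its distance from the ball.\<close>
  have t_far: "path_image t \<subseteq> - closure (ball p R)"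
  proof
    fix y assume "y \<in> path_image t"
    then obtain u where u: "u \<in> {0..1}" "y = t u" by (auto simp: path_image_def)
    have "ennreal (dist (t 0) (t u) + dist (t u) (t 1)) < ennreal (r * ?d)"
      using dist_le_curve_length[OF u(1), of t] \<tau>(4) unfolding t_def by (rule order_le_less_trans)
    then have "dist (t 0) (t u) + dist (t u) (t 1) < r * ?d"
      by (subst (asm) ennreal_less_iff) auto
    then have "2 * dist (\<pi> e) y < r * ?d"
      using t(2,3) u(2) by (simp add: pathstart_def pathfinish_def dist_commute)
    moreover have "?d \<le> dist (\<pi> e) y + dist p y + dist x0 p"
      using dist_triangle[of "\<pi> e" x0 y] dist_triangle[of y x0 p] by (simp add: dist_commute)
    ultimately have "R < dist p y"
      using far by (simp add: algebra_simps)
    moreover have "closure (ball p R) \<subseteq> cball p R"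
      by (rule closure_minimal) auto
    ultimately show "y \<in> - closure (ball p R)" by auto
  qed
  obtain s where s: "path s" "pathstart s = \<pi> e0" "transport s e0 = e"
    using rectifiable_transport[OF e0 e(1)] by blast
  have s_fin: "pathfinish s = \<pi> e"
    using projection_transport[of s e0] s e0 by simp
  let ?\<rho> = "c +++ (s +++ (t +++ reversepath s))"
  \<comment> \<open>The lift goes from \<open>e0\<close> to \<open>h e0\<close>, then along the translate of the lift of \<open>s\<close> to \<open>h e\<close>, then to \<open>e\<close>
    and back to \<open>e0\<close>.\<close>
  have "transport ?\<rho> e0 = e0"
  proof -
    have "transport s (h e0) = h e"
      using transport_deck_transformation[OF h s(1) e0] s(2,3) by simp
    moreover have "transport (reversepath s) e = e0"
      using transport_reversepath[of s e0] s e0 by simp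
    ultimately show ?thesis
      using c s s_fin t t_lift e0 e(1) h_top by (simp add: transport_join)
  qed
  then have "path_class (a +++ (?\<rho> +++ reversepath a)) \<in> N"
    using c s s_fin t a e0 by (intro closed_lift_in_normal[OF N \<delta> gens e0]) auto
  moreover have "path_class (a +++ (?\<rho> +++ reversepath a)) =
      path_class (a +++ (c +++ reversepath a)) \<otimes>\<^bsub>fundamental_group p\<^esub>
      path_class ((a +++ s) +++ (t +++ reversepath (a +++ s)))"
  proof -
    have "homotopic ((a +++ (c +++ reversepath a)) +++ ((a +++ s) +++ (t +++ reversepath (a +++ s))))
        (a +++ (?\<rho> +++ reversepath a))"
      using a c s s_fin t by (intro homotopic_conjugate_product) auto
    then have "path_class (a +++ (?\<rho> +++ reversepath a)) =
        path_class ((a +++ (c +++ reversepath a)) +++ ((a +++ s) +++ (t +++ reversepath (a +++ s))))"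
      by (rule path_class_eqI[symmetric])
    also have "\<dots> = path_class (a +++ (c +++ reversepath a)) \<otimes>\<^bsub>fundamental_group p\<^esub>
        path_class ((a +++ s) +++ (t +++ reversepath (a +++ s)))"
      using a c s s_fin t by (intro mult_path_class[symmetric]) auto
    finally show ?thesis .
  qed
  moreover have "path_class ((a +++ s) +++ (t +++ reversepath (a +++ s))) \<in> N"
  proof (rule subsetD[OF gens])
    show "path_class ((a +++ s) +++ (t +++ reversepath (a +++ s))) \<in> cutoff_generators p \<delta> R"
      unfolding cutoff_generators_def using a s s_fin t t_far
      by (intro CollectI exI[of _ "a +++ s"] exI[of _ t]) auto
  qed
  moreover have "path_class (a +++ (c +++ reversepath a)) \<in> carrier (fundamental_group p)"
    using a c by (intro path_class_loopI) auto
  ultimately have "path_class (a +++ (c +++ reversepath a)) \<in> N"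
    using mem_of_mult_mem by metis
  then show ?thesis
    using base_change_path_class[of a c] a c by simp
qed

end

theorem theorem6p3:
  fixes Xt :: "'b topology" and \<pi> :: "'b \<Rightarrow> 'a::complete_space"
    and e0 :: 'b and x0 p :: 'a
  assumes "length_space TYPE('a)"
    and "\<not> compact (UNIV :: 'a set)"
    and "\<not> bounded (UNIV :: 'a set)"
    and "universal_cover Xt \<pi>"
    and "e0 \<in> topspace Xt"
    and "CovSpec_rs_inf Xt \<pi> e0 x0 \<subseteq> {0<..<1}"
  shows "CovSpec_cut p = {}"
proof -
  interpret universal_length_cover Xt \<pi>
    by unfold_locales (use assms(1,4) in \<open>auto simp: universal_cover_def cover_of_space_def\<close>)
  let ?G = "fundamental_group (\<pi> e0)"
  let ?L = "inf_rescaled_length Xt \<pi> e0 x0"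
  note e0 = assms(5)
  \<comment> \<open>Every rescaled length is at most \<open>2\<close>, so just above \<open>1\<close> the groups in the rescaled spectrum are
    everything; as \<open>1\<close> is not in the spectrum, the group at \<open>1\<close> is everything, too.\<close>
  have "1 \<notin> CovSpec_rs_inf Xt \<pi> e0 x0"
    using assms(6) by auto
  then obtain \<delta>' where \<delta>': "\<delta>' > 1" "pi_rs_inf Xt \<pi> e0 x0 1 = pi_rs_inf Xt \<pi> e0 x0 \<delta>'"
    by (auto simp: CovSpec_rs_inf_def)
  have "carrier ?G \<subseteq> pi_rs_inf Xt \<pi> e0 x0 \<delta>'"
  proof
    fix g assume g: "g \<in> carrier ?G"
    have "?L g \<le> ennreal 2"
      using inf_rescaled_length_le_2[OF e0 g assms(3)] by simp
    also have "\<dots> < ennreal (2 * \<delta>')"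
      using \<delta>'(1) by (intro ennreal_lessI) auto
    finally show "g \<in> pi_rs_inf Xt \<pi> e0 x0 \<delta>'"
      unfolding pi_rs_inf_def using g by (intro generate.incl) auto
  qed
  then have gen: "carrier ?G \<subseteq> generate ?G {g \<in> carrier ?G. ?L g < 2}"
    using \<delta>'(2) by (simp add: pi_rs_inf_def)
  obtain a where a: "path a" "pathstart a = p" "pathfinish a = \<pi> e0"
    using length_space_geodesic[OF assms(1), of p "\<pi> e0"] by metis
  interpret \<phi>: group_hom ?G "fundamental_group p" "base_change a"
    by (rule base_change_hom[OF a])
  have everything: "N = carrier (fundamental_group p)"
    if N: "N \<lhd> fundamental_group p" and gens: "cutoff_generators p \<delta> R \<subseteq> N" and \<delta>: "\<delta> > 0" and R: "R > 0"
    for N \<delta> R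
  proof
    have K: "subgroup N (fundamental_group p)"
      using N by (simp add: normal_def)
    show "N \<subseteq> carrier (fundamental_group p)"
      using subgroup.subset[OF K] .
    have "base_change a g \<in> N" if "g \<in> generate ?G {g \<in> carrier ?G. ?L g < 2}" for g
      using that
    proof (induction rule: generate.induct)
      case one
      then show ?case using subgroup.one_closed[OF K] by simp
    next
      case (incl g)
      then show ?case
        using base_change_in_normal_if_short[OF N \<delta> R gens e0 _ _ a] by blast
    next
      case (inv g)
      then have "base_change a g \<in> N"
        using base_change_in_normal_if_short[OF N \<delta> R gens e0 _ _ a] by blast
      then show ?case
        using inv subgroup.m_inv_closed[OF K] by simp
    next
      case (eng g g')
      moreover have "g \<in> carrier ?G" "g' \<in> carrier ?G"
        using \<phi>.G.generate_in_carrier[of "{g \<in> carrier ?G. ?L g < 2}"] eng(1,2) by blast+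
      ultimately show ?case
        using subgroup.m_closed[OF K] by simp
    qed
    then show "carrier (fundamental_group p) \<subseteq> N"
      using base_change_surj[OF a] gen by blast
  qed
  have N_all: "normal_closure (fundamental_group p) (cutoff_generators p \<delta> R) = carrier (fundamental_group p)"
    if "\<delta> > 0" "R > 0" for \<delta> R
    unfolding normal_closure_def
    using everything[OF _ _ that] group.normal_self[OF group_fundamental_group[of p]]
      cutoff_generators_subset[of p \<delta> R] by blast
  have "CovSpec_cut_R p R = {}" if R: "R > 0" for R
  proof -
    have "\<delta> \<notin> CovSpec_cut_R p R" if \<delta>: "\<delta> > 0" for \<delta>
    proof -
      obtain E :: "(real \<Rightarrow> 'a) set topology" and q where E: "is_cutoff_cover p \<delta> R E q"
        using cutoff_cover_exists[OF assms(1) \<delta>] .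
      then have "is_cutoff_cover p (\<delta> + 1) R E q"
        using N_all[OF \<delta> R] N_all[of "\<delta> + 1" R] \<delta> R by (simp add: is_cutoff_cover_def)
      moreover have "cover_isomorphic E q E q"
        unfolding cover_isomorphic_def by (intro exI[of _ id]) auto
      ultimately show ?thesis
        using E unfolding CovSpec_cut_R_def by (auto intro!: exI[of _ "\<delta> + 1"])
    qed
    then show ?thesis
      by (auto simp: CovSpec_cut_R_def)
  qed
  then show ?thesis
    by (auto simp: CovSpec_cut_def Cl_lower_def)
qed

end
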